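(* Let $n\ge1$, let $\theta$ be a real skew-symmetric $n\times n$ matrix, and let $k\in\mathbb{N}$ satisfy $k>n/2$. Let $q\in\mathbb{N}$, and for $0\le\nu\le q$ and $1\le\mu\le N_\nu$ let $b_{\nu,\mu,0},\dots,b_{\nu,\mu,\nu}\in H^k_\theta$. Define the noncommutative polynomial $$\mathcal{P}(u)=\sum_{\nu=0}^q\sum_{\mu=1}^{N_\nu}b_{\nu,\mu,0}\,u\,b_{\nu,\mu,1}\,u\cdots u\,b_{\nu,\mu,\nu},$$ where the term with $\nu=0$ is interpreted as $b_{0,\mu,0}$. Then $\mathcal{P}:H^k_\theta\to H^k_\theta$ is locally Lipschitz. More precisely, there exists a constant $C_{\mathcal{P},k,n}>0$ such that $$\|\mathcal{P}(u)\|_{H^k_\theta}\le C_{\mathcal{P},k,n}\bigl(1+\|u\|_{H^k_\theta}^q\bigr),\qquad u\in H^k_\theta,$$ and for every $R>0$ there exists $C_{\mathcal{P},k,n,R}>0$ such that $$\|\mathcal{P}(u)-\mathcal{P}(v)\|_{H^k_\theta}\le C_{\mathcal{P},k,n,R}\|u-v\|_{H^k_\theta}$$ whenever $\|u\|_{H^k_\theta}\le R$ and $\|v\|_{H^k_\theta}\le R$.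
   Context: $\mathbb{N}=\{1,2,\dots\}$; the $N_\nu$ are finite nonnegative integers. Let $\theta=(\theta_{jk})$ be a real skew-symmetric $n\times n$ matrix. Let $U_1,\dots,U_n$ be unitaries with $U_kU_j=e^{2\pi i\theta_{kj}}U_jU_k$, realized in the standard representation on $\ell^2(\mathbb{Z}^n)$ (with canonical basis $(e_m)$): $U_je_m=e^{2\pi i\sum_{l<j}\theta_{jl}m_l}e_{m+\epsilon_j}$, where $\epsilon_j$ is the $j$-th unit vector. The noncommutative torus $\mathbb{T}_\theta^n=L^\infty(\mathbb{T}_\theta^n)$ is the von Neumann algebra they generate. For $m\in\mathbb{Z}^n$ put $U^m=U_1^{m_1}\cdots U_n^{m_n}$. The smooth algebra $\mathcal{A}_\theta^\infty$ is the set of all series $\sum_mc_mU^m$ with rapidly decreasing coefficients. The canonical trace $\tau$ is the faithful normal tracial state with $\tau(\sum c_mU^m)=c_0$ on $\mathcal{A}_\theta^\infty$. $L^2(\mathbb{T}_\theta^n)$ is the completion of $\mathcal{A}_\theta^\infty$ for $\|a\|_{L^2}=\tau(|a|^2)^{1/2}$; $\{U^m\}$ is an orthonormal basis of it, and $\widehat a(m)=\tau((U^m)^*a)$ are the Fourier coefficients. For $s\ge0$, $H^s_\theta$ is the set of $a\in L^2(\mathbb{T}_\theta^n)$ with $\|a\|_{H^s_\theta}^2=\sum_{m\in\mathbb{Z}^n}(1+4\pi^2|m|^2)^s|\widehat a(m)|^2<\infty$, where $|m|^2=m_1^2+\cdots+m_n^2$. For $k>n/2$ one has $H^k_\theta\subset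 L^\infty(\mathbb{T}_\theta^n)$ (inside $L^2(\mathbb{T}_\theta^n)$), and products are taken in $L^\infty(\mathbb{T}_\theta^n)$. A map of a normed space into itself is called locally Lipschitz if it is Lipschitz on every ball $\{\|u\|\le R\}$, $R>0$. *)

theory Defs
  imports "HOL-Analysis.Analysis"
begin

section \<open>The complex Hilbert space of square-summable families\<close>

typedef 'i ell2 = "{f :: 'i \<Rightarrow> complex. (\<lambda>i. (cmod (f i))\<^sup>2) summable_on UNIV}"
  morphisms coord Abs_ell2
  by (rule exI[of _ "\<lambda>_. 0"]) simp

setup_lifting type_definition_ell2

lemma coord_summable: "(\<lambda>i. (cmod (coord x i))\<^sup>2) summable_on UNIV"
  using coord[of x] by simp

lemma ell2_eqI: "(\<And>i. coord x i = coord y i) \<Longrightarrow> x = y"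
  by (simp add: coord_inject[symmetric] fun_eq_iff)

lemma summable_sq_L2_setI:
  fixes f :: "'i \<Rightarrow> complex"
  assumes "\<And>F. finite F \<Longrightarrow> L2_set (\<lambda>i. cmod (f i)) F \<le> B"
  shows "(\<lambda>i. (cmod (f i))\<^sup>2) summable_on UNIV"
    and "sqrt (\<Sum>\<^sub>\<infinity>i. (cmod (f i))\<^sup>2) \<le> B"
proof -
  have B: "0 \<le> B" using assms[of "{}"] by simp
  have *: "(\<Sum>i\<in>F. (cmod (f i))\<^sup>2) \<le> B\<^sup>2" if "finite F" for F
    using assms[OF that] B by (simp add: L2_set_def real_le_lsqrt sqrt_le_D)
  show s: "(\<lambda>i. (cmod (f i))\<^sup>2) summable_on UNIV"
    by (rule nonneg_bdd_above_summable_on) (auto intro!: bdd_aboveI2[where M = "B\<^sup>2"] *)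
  have "(\<Sum>\<^sub>\<infinity>i. (cmod (f i))\<^sup>2) \<le> B\<^sup>2"
    by (rule infsum_le_finite_sums[OF s]) (use * in auto)
  then show "sqrt (\<Sum>\<^sub>\<infinity>i. (cmod (f i))\<^sup>2) \<le> B"
    using B by (simp add: real_le_lsqrt)
qed

lemma L2_set_le_sqrt_infsum:
  fixes f :: "'i \<Rightarrow> complex"
  assumes "(\<lambda>i. (cmod (f i))\<^sup>2) summable_on UNIV" "finite F"
  shows "L2_set (\<lambda>i. cmod (f i)) F \<le> sqrt (\<Sum>\<^sub>\<infinity>i. (cmod (f i))\<^sup>2)"
  unfolding L2_set_def
  by (rule real_sqrt_le_mono, rule finite_sum_le_infsum) (use assms in auto)

lemma L2_set_cmod_add:
  "L2_set (\<lambda>i. cmod (f i + g i)) F \<le> L2_set (\<lambda>i. cmod (f i)) F + L2_set (\<lambda>i. cmod (g i)) F"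
proof -
  have "L2_set (\<lambda>i. cmod (f i + g i)) F \<le> L2_set (\<lambda>i. cmod (f i) + cmod (g i)) F"
    by (rule L2_set_mono) (auto intro: norm_triangle_ineq)
  also have "\<dots> \<le> L2_set (\<lambda>i. cmod (f i)) F + L2_set (\<lambda>i. cmod (g i)) F"
    by (rule L2_set_triangle_ineq)
  finally show ?thesis .
qed

lemma summable_sq_add:
  fixes f g :: "'i \<Rightarrow> complex"
  assumes "(\<lambda>i. (cmod (f i))\<^sup>2) summable_on UNIV" "(\<lambda>i. (cmod (g i))\<^sup>2) summable_on UNIV"
  shows "(\<lambda>i. (cmod (f i + g i))\<^sup>2) summable_on UNIV"
    and "sqrt (\<Sum>\<^sub>\<infinity>i. (cmod (f i + g i))\<^sup>2)
           \<le> sqrt (\<Sum>\<^sub>\<infinity>i. (cmod (f i))\<^sup>2) + sqrt (\<Sum>\<^sub>\<infinity>i. (cmod (g i))\<^sup>2)"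
proof -
  have "L2_set (\<lambda>i. cmod (f i + g i)) F
      \<le> sqrt (\<Sum>\<^sub>\<infinity>i. (cmod (f i))\<^sup>2) + sqrt (\<Sum>\<^sub>\<infinity>i. (cmod (g i))\<^sup>2)" if "finite F" for F
    using L2_set_cmod_add[of f g F] L2_set_le_sqrt_infsum[OF assms(1) that]
      L2_set_le_sqrt_infsum[OF assms(2) that] by linarith
  from summable_sq_L2_setI[of "\<lambda>i. f i + g i", OF this]
  show "(\<lambda>i. (cmod (f i + g i))\<^sup>2) summable_on UNIV"
    and "sqrt (\<Sum>\<^sub>\<infinity>i. (cmod (f i + g i))\<^sup>2)
           \<le> sqrt (\<Sum>\<^sub>\<infinity>i. (cmod (f i))\<^sup>2) + sqrt (\<Sum>\<^sub>\<infinity>i. (cmod (g i))\<^sup>2)"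
    by auto
qed

lemma summable_sq_scale:
  fixes f :: "'i \<Rightarrow> complex"
  assumes "(\<lambda>i. (cmod (f i))\<^sup>2) summable_on UNIV"
  shows "(\<lambda>i. (cmod (c * f i))\<^sup>2) summable_on UNIV"
  using summable_on_cmult_right[OF assms, of "(cmod c)\<^sup>2"]
  by (simp add: norm_mult power_mult_distrib)

instantiation ell2 :: (type) real_normed_vector
begin

lift_definition zero_ell2 :: "'a ell2" is "\<lambda>_. 0" by simp

lift_definition plus_ell2 :: "'a ell2 \<Rightarrow> 'a ell2 \<Rightarrow> 'a ell2" is "\<lambda>f g i. f i + g i"
  by (rule summable_sq_add)

lift_definition uminus_ell2 :: "'a ell2 \<Rightarrow> 'a ell2" is "\<lambda>f i. - f i" by simp

lift_definition scaleR_ell2 :: "real \<Rightarrow> 'a ell2 \<Rightarrow> 'a ell2" is "\<lambda>r f i. complex_of_real r * f i"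
  by (rule summable_sq_scale)

definition "x - y = x + (- y :: 'a ell2)"

definition norm_ell2 :: "'a ell2 \<Rightarrow> real"
  where "norm_ell2 x = sqrt (\<Sum>\<^sub>\<infinity>i. (cmod (coord x i))\<^sup>2)"

definition "dist x y = norm (x - y :: 'a ell2)"
definition "sgn x = inverse (norm x) *\<^sub>R (x :: 'a ell2)"
definition "uniformity = (INF e\<in>{0<..}. principal {(x :: 'a ell2, y). dist x y < e})"
definition "open U = (\<forall>x\<in>U. \<forall>\<^sub>F (x', y :: 'a ell2) in uniformity. x' = x \<longrightarrow> y \<in> U)"

instance
proof
  fix x y z :: "'a ell2" and r s :: real
  show "x + y + z = x + (y + z)" by transfer (simp add: add.assoc)
  show "x + y = y + x" by transfer (simp add: add.commute)
  show "0 + x = x" by transfer simp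
  show "- x + x = 0" by transfer simp
  show "x - y = x + - y" by (rule minus_ell2_def)
  show "r *\<^sub>R (x + y) = r *\<^sub>R x + r *\<^sub>R y" by transfer (simp add: algebra_simps)
  show "(r + s) *\<^sub>R x = r *\<^sub>R x + s *\<^sub>R x" by transfer (simp add: algebra_simps)
  show "r *\<^sub>R s *\<^sub>R x = (r * s) *\<^sub>R x" by transfer (simp add: algebra_simps)
  show "1 *\<^sub>R x = x" by transfer simp
  show "dist x y = norm (x - y)" by (simp add: dist_ell2_def)
  show "sgn x = inverse (norm x) *\<^sub>R x" by (simp add: sgn_ell2_def)
  show "uniformity = (INF e\<in>{0<..}. principal {(x :: 'a ell2, y). dist x y < e})"
    by (simp add: uniformity_ell2_def)
  show "open U = (\<forall>x\<in>U. \<forall>\<^sub>F (x', y) in uniformity. x' = x \<longrightarrow> y \<in> U)" for U :: "'a ell2 set"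
    by (simp add: open_ell2_def)
  show "(norm x = 0) = (x = 0)"
  proof
    assume "norm x = 0"
    then have "(\<Sum>\<^sub>\<infinity>i. (cmod (coord x i))\<^sup>2) = 0" by (simp add: norm_ell2_def)
    then have "(cmod (coord x i))\<^sup>2 = 0" for i
      by (intro nonneg_infsum_le_0D[of "\<lambda>i. (cmod (coord x i))\<^sup>2" UNIV i]) (auto intro: coord_summable)
    then have "coord x i = 0" for i by simp
    then show "x = 0" by (intro ell2_eqI) (simp add: zero_ell2.rep_eq)
  qed (simp add: norm_ell2_def zero_ell2.rep_eq)
  show "norm (x + y) \<le> norm x + norm y"
    unfolding norm_ell2_def plus_ell2.rep_eq
    by (rule summable_sq_add(2)[OF coord_summable coord_summable])
  show "norm (r *\<^sub>R x) = \<bar>r\<bar> * norm x"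
  proof -
    have "(\<Sum>\<^sub>\<infinity>i. (cmod (coord (r *\<^sub>R x) i))\<^sup>2) = (\<Sum>\<^sub>\<infinity>i. r\<^sup>2 * (cmod (coord x i))\<^sup>2)"
      by (simp only: scaleR_ell2.rep_eq norm_mult power_mult_distrib norm_of_real power2_abs)
    also have "\<dots> = r\<^sup>2 * (\<Sum>\<^sub>\<infinity>i. (cmod (coord x i))\<^sup>2)"
      by (rule infsum_cmult_right')
    finally show ?thesis
      by (simp only: norm_ell2_def real_sqrt_mult real_sqrt_abs)
  qed
qed

end

lemma coord_simps [simp]:
  "coord 0 i = 0" "coord (x + y) i = coord x i + coord y i" "coord (- x) i = - coord x i"
  "coord (x - y) i = coord x i - coord y i" "coord (r *\<^sub>R x) i = complex_of_real r * coord x i"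
  by (simp_all only: zero_ell2.rep_eq plus_ell2.rep_eq uminus_ell2.rep_eq scaleR_ell2.rep_eq
      minus_ell2_def) simp

lemma norm_ell2_sq: "(norm x)\<^sup>2 = (\<Sum>\<^sub>\<infinity>i. (cmod (coord x i))\<^sup>2)" for x :: "'i ell2"
  by (simp add: norm_ell2_def infsum_nonneg)

lemma L2_set_coord_le_norm: "finite F \<Longrightarrow> L2_set (\<lambda>i. cmod (coord x i)) F \<le> norm x" for x :: "'i ell2"
  unfolding norm_ell2_def by (rule L2_set_le_sqrt_infsum[OF coord_summable])

lemma cmod_coord_le_norm: "cmod (coord x i) \<le> norm x" for x :: "'i ell2"
  using L2_set_coord_le_norm[of "{i}" x] by simp

instance ell2 :: (type) banach
proof
  fix X :: "nat \<Rightarrow> 'a ell2"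
  assume X: "Cauchy X"
  have "Cauchy (\<lambda>n. coord (X n) i)" for i
  proof (rule metric_CauchyI)
    fix e :: real assume "0 < e"
    then obtain M where "\<forall>m\<ge>M. \<forall>n\<ge>M. dist (X m) (X n) < e"
      using metric_CauchyD[OF X] by blast
    moreover have "dist (coord (X m) i) (coord (X n) i) \<le> dist (X m) (X n)" for m n
      using cmod_coord_le_norm[of "X m - X n" i] by (simp add: dist_norm)
    ultimately show "\<exists>M. \<forall>m\<ge>M. \<forall>n\<ge>M. dist (coord (X m) i) (coord (X n) i) < e"
      by (meson le_less_trans)
  qed
  then have "\<exists>l. (\<lambda>n. coord (X n) i) \<longlonglongrightarrow> l" for i
    by (simp add: Cauchy_convergent_iff convergent_def)
  then obtain f where f: "\<And>i. (\<lambda>n. coord (X n) i) \<longlonglongrightarrow> f i" by metis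
  have bd: "\<exists>M. \<forall>n\<ge>M. \<forall>F. finite F \<longrightarrow> L2_set (\<lambda>i. cmod (f i - coord (X n) i)) F \<le> e"
    if e: "0 < e" for e
  proof -
    from e obtain M where M: "\<forall>m\<ge>M. \<forall>n\<ge>M. norm (X m - X n) < e"
      using CauchyD[OF X] by blast
    have "L2_set (\<lambda>i. cmod (f i - coord (X n) i)) F \<le> e" if "n \<ge> M" "finite F" for n F
    proof (rule tendsto_upperbound)
      show "(\<lambda>m. L2_set (\<lambda>i. cmod (coord (X m) i - coord (X n) i)) F)
              \<longlonglongrightarrow> L2_set (\<lambda>i. cmod (f i - coord (X n) i)) F"
        unfolding L2_set_def by (intro tendsto_intros f)
      show "\<forall>\<^sub>F m in sequentially. L2_set (\<lambda>i. cmod (coord (X m) i - coord (X n) i)) F \<le> e"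
      proof (rule eventually_sequentiallyI[of M])
        fix m assume "M \<le> m"
        then have "norm (X m - X n) < e" using M that by blast
        then show "L2_set (\<lambda>i. cmod (coord (X m) i - coord (X n) i)) F \<le> e"
          using L2_set_coord_le_norm[OF that(2), of "X m - X n"] by simp
      qed
    qed simp
    then show ?thesis by blast
  qed
  obtain M where M: "\<And>F. finite F \<Longrightarrow> L2_set (\<lambda>i. cmod (f i - coord (X M) i)) F \<le> 1"
    using bd[of 1] by auto
  have "(\<lambda>i. (cmod ((f i - coord (X M) i) + coord (X M) i))\<^sup>2) summable_on UNIV"
    using summable_sq_add(1)[of "\<lambda>i. f i - coord (X M) i" "coord (X M)"]
      summable_sq_L2_setI(1)[of "\<lambda>i. f i - coord (X M) i" 1] M coord_summable[of "X M"] by blast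
  then have cf: "coord (Abs_ell2 f) = f" by (simp add: Abs_ell2_inverse)
  have "X \<longlonglongrightarrow> Abs_ell2 f"
  proof (rule LIMSEQ_I)
    fix r :: real assume r: "0 < r"
    then obtain N where N: "\<forall>n\<ge>N. \<forall>F. finite F \<longrightarrow> L2_set (\<lambda>i. cmod (f i - coord (X n) i)) F \<le> r/2"
      using bd[of "r/2"] by auto
    have "norm (X n - Abs_ell2 f) < r" if "n \<ge> N" for n
    proof -
      have "norm (Abs_ell2 f - X n) \<le> r/2"
        using summable_sq_L2_setI(2)[of "\<lambda>i. f i - coord (X n) i" "r/2"] N that
        by (simp add: norm_ell2_def cf)
      then show ?thesis using r by (simp add: norm_minus_commute)
    qed
    then show "\<exists>no. \<forall>n\<ge>no. norm (X n - Abs_ell2 f) < r" by blast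
  qed
  then show "convergent X" by (rule convergentI)
qed

lift_definition scaleC :: "complex \<Rightarrow> 'i ell2 \<Rightarrow> 'i ell2" is "\<lambda>c f i. c * f i"
  by (rule summable_sq_scale)

lift_definition ket :: "'i \<Rightarrow> 'i ell2" is "\<lambda>m i. if i = m then 1 else 0"
  by (rule finite_nonzero_values_imp_summable_on) simp

text \<open>The inner product is linear in its second argument.\<close>

definition cinner :: "'i ell2 \<Rightarrow> 'i ell2 \<Rightarrow> complex"
  where "cinner x y = (\<Sum>\<^sub>\<infinity>i. cnj (coord x i) * coord y i)"

lemma cinner_ket [simp]: "cinner (ket m) x = coord x m"
proof -
  have "cinner (ket m) x = (\<Sum>\<^sub>\<infinity>i\<in>{m}. cnj (coord (ket m) i) * coord x i)"
    unfolding cinner_def by (rule infsum_cong_neutral) (auto simp: ket.rep_eq)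
  then show ?thesis by (simp add: ket.rep_eq)
qed

lemma cinner_commute: "cinner y x = cnj (cinner x y)"
  unfolding cinner_def by (simp add: mult.commute flip: infsum_cnj)

lemma cinner_self: "cinner x x = complex_of_real ((norm x)\<^sup>2)"
proof -
  have "cinner x x = (\<Sum>\<^sub>\<infinity>i. complex_of_real ((cmod (coord x i))\<^sup>2))"
    unfolding cinner_def
    by (rule infsum_cong) (metis complex_norm_square mult.commute of_real_power)
  also have "\<dots> = complex_of_real (\<Sum>\<^sub>\<infinity>i. (cmod (coord x i))\<^sup>2)"
    by (rule infsumI, rule has_sum_of_real, rule has_sum_infsum, rule coord_summable)
  finally show ?thesis by (simp add: norm_ell2_sq)
qed


section \<open>Operators\<close>

text \<open>Elements of type \<open>'i ell2 \<Rightarrow>\<^sub>L 'i ell2\<close> are bounded and real-linear;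
  the algebra of bounded complex-linear operators is singled out as a subset.\<close>

type_synonym 'i oper = "'i ell2 \<Rightarrow>\<^sub>L 'i ell2"

definition clinear_ops :: "'i oper set"
  where "clinear_ops = {T. \<forall>c x. blinfun_apply T (scaleC c x) = scaleC c (blinfun_apply T x)}"

definition scal :: "complex \<Rightarrow> 'i oper"
  where "scal c = Blinfun (scaleC c)"

lemma norm_scaleC: "norm (scaleC c x) = cmod c * norm x"
proof -
  have "(\<Sum>\<^sub>\<infinity>i. (cmod (coord (scaleC c x) i))\<^sup>2) = (\<Sum>\<^sub>\<infinity>i. (cmod c)\<^sup>2 * (cmod (coord x i))\<^sup>2)"
    by (simp only: scaleC.rep_eq norm_mult power_mult_distrib norm_of_real power2_abs)
  also have "\<dots> = (cmod c)\<^sup>2 * (\<Sum>\<^sub>\<infinity>i. (cmod (coord x i))\<^sup>2)"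
    by (rule infsum_cmult_right')
  finally show ?thesis
    by (simp only: norm_ell2_def real_sqrt_mult real_sqrt_abs abs_norm_cancel)
qed

lemma scal_apply [simp]: "blinfun_apply (scal c) x = scaleC c x" for x :: "'i ell2"
proof -
  have "bounded_linear (scaleC c :: 'i ell2 \<Rightarrow> 'i ell2)"
    by (rule bounded_linear_intro[where K = "cmod c"])
      (auto intro!: ell2_eqI simp: scaleC.rep_eq algebra_simps norm_scaleC)
  then show ?thesis by (simp add: scal_def bounded_linear_Blinfun_apply)
qed

definition is_adjoint :: "'i oper \<Rightarrow> 'i oper \<Rightarrow> bool"
  where "is_adjoint S T \<longleftrightarrow> (\<forall>x y. cinner (blinfun_apply S x) y = cinner x (blinfun_apply T y))"

definition adj :: "'i oper \<Rightarrow> 'i oper"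
  where "adj T = (THE S. is_adjoint S T)"

lemma adj_eqI:
  fixes S T :: "'i oper"
  assumes "is_adjoint S T"
  shows "adj T = S"
  unfolding adj_def
proof (rule the_equality)
  fix S' assume S': "is_adjoint S' T"
  have "coord (blinfun_apply S' x) m = coord (blinfun_apply S x) m" for x m
  proof -
    have "cinner (blinfun_apply S' x) (ket m) = cinner (blinfun_apply S x) (ket m)"
      using S' assms by (simp add: is_adjoint_def)
    then have "cinner (ket m) (blinfun_apply S' x) = cinner (ket m) (blinfun_apply S x)"
      by (metis cinner_commute)
    then show ?thesis by simp
  qed
  then show "S' = S" by (intro blinfun_eqI ell2_eqI)
qed (rule assms)

definition commutant :: "'i oper set \<Rightarrow> 'i oper set"
  where "commutant M = {T \<in> clinear_ops. \<forall>S\<in>M. T o\<^sub>L S = S o\<^sub>L T}"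

definition vN_generated :: "'i oper set \<Rightarrow> 'i oper set"
  where "vN_generated M = commutant (commutant (M \<union> adj ` M))"

text \<open>Integer powers of a unitary, whose inverse is its adjoint.\<close>

definition unitary_powi :: "'i oper \<Rightarrow> int \<Rightarrow> 'i oper"
  where "unitary_powi T z =
    (if 0 \<le> z then (((o\<^sub>L) T) ^^ nat z) id_blinfun else (((o\<^sub>L) (adj T)) ^^ nat (- z)) id_blinfun)"


section \<open>The noncommutative torus\<close>

text \<open>The index type \<open>'n\<close>, a finite nonempty linear order, plays the role of \<open>1 < \<dots> < n\<close>.\<close>

type_synonym 'n rmat = "((real, 'n) vec, 'n) vec"
type_synonym 'n zvec = "(int, 'n) vec"

definition U_phase :: "'n::{finite,linorder} rmat \<Rightarrow> 'n::{finite,linorder} \<Rightarrow> 'n::{finite,linorder} zvec \<Rightarrow> complex"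
  where "U_phase \<theta> j m = exp (2 * of_real pi * \<i> * of_real (\<Sum>l | l < j. \<theta> $ j $ l * real_of_int (m $ l)))"

lemma norm_U_phase [simp]: "cmod (U_phase \<theta> j m) = 1"
proof -
  have "U_phase \<theta> j m = exp (\<i> * of_real (2 * pi * (\<Sum>l | l < j. \<theta> $ j $ l * real_of_int (m $ l))))"
    by (simp add: U_phase_def mult.assoc mult.commute mult.left_commute)
  then show ?thesis by (simp only: norm_exp_i_times)
qed

lemma bij_shift: "bij (\<lambda>m. m - a)" for a :: "'a::group_add"
  by (rule bij_betw_byWitness[where f' = "\<lambda>m. m + a"]) auto

lemma summable_shift:
  fixes f :: "'n::{finite,linorder} zvec \<Rightarrow> complex"
  assumes "(\<lambda>i. (cmod (f i))\<^sup>2) summable_on UNIV"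
  shows "(\<lambda>m. (cmod (U_phase \<theta> j (m - a) * f (m - a)))\<^sup>2) summable_on UNIV"
  using summable_on_reindex_bij_betw[OF bij_shift, of "\<lambda>i. (cmod (f i))\<^sup>2" a] assms
  by (simp add: norm_mult)

text \<open>\<open>U_fun \<theta> j\<close> is the isometry sending \<open>e\<^sub>m\<close> to \<open>U_phase \<theta> j m \<cdot> e\<^bsub>m+\<epsilon>\<^sub>j\<^esub>\<close>,
  see \<open>U_ket\<close> below.\<close>

lift_definition U_fun :: "'n::{finite,linorder} rmat \<Rightarrow> 'n::{finite,linorder} \<Rightarrow> ('n::{finite,linorder} zvec) ell2 \<Rightarrow> ('n::{finite,linorder} zvec) ell2"
  is "\<lambda>\<theta> j f m. U_phase \<theta> j (m - axis j 1) * f (m - axis j 1)"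
  by (rule summable_shift)

definition U :: "'n::{finite,linorder} rmat \<Rightarrow> 'n::{finite,linorder} \<Rightarrow> ('n::{finite,linorder} zvec) oper"
  where "U \<theta> j = Blinfun (U_fun \<theta> j)"

lemma norm_U_fun: "norm (U_fun \<theta> j x) = norm x"
  unfolding norm_ell2_def U_fun.rep_eq
  using infsum_reindex_bij_betw[OF bij_shift, of "\<lambda>i. (cmod (coord x i))\<^sup>2" "axis j 1"]
  by (simp add: norm_mult)

lemma U_apply: "blinfun_apply (U \<theta> j) x = U_fun \<theta> j x"
proof -
  have "bounded_linear (U_fun \<theta> j)"
    by (rule bounded_linear_intro[where K = 1])
      (auto intro!: ell2_eqI simp: U_fun.rep_eq algebra_simps norm_U_fun)
  then show ?thesis by (simp add: U_def bounded_linear_Blinfun_apply)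
qed

lemma U_ket: "blinfun_apply (U \<theta> j) (ket m) = scaleC (U_phase \<theta> j m) (ket (m + axis j 1))"
  by (rule ell2_eqI) (auto simp: U_apply U_fun.rep_eq scaleC.rep_eq ket.rep_eq diff_eq_eq)

lift_definition Ustar_fun :: "'n::{finite,linorder} rmat \<Rightarrow> 'n \<Rightarrow> 'n zvec ell2 \<Rightarrow> 'n zvec ell2"
  is "\<lambda>\<theta> j f m. cnj (U_phase \<theta> j m) * f (m + axis j 1)"
proof -
  fix \<theta> :: "'n rmat" and j and f :: "'n zvec \<Rightarrow> complex"
  assume "(\<lambda>i. (cmod (f i))\<^sup>2) summable_on UNIV"
  then show "(\<lambda>m. (cmod (cnj (U_phase \<theta> j m) * f (m + axis j 1)))\<^sup>2) summable_on UNIV"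
    using summable_on_reindex_bij_betw[OF bij_shift, of "\<lambda>i. (cmod (f i))\<^sup>2" "- axis j 1"]
    by (simp add: norm_mult)
qed

lemma norm_Ustar_fun: "norm (Ustar_fun \<theta> j x) = norm x"
  unfolding norm_ell2_def Ustar_fun.rep_eq
  using infsum_reindex_bij_betw[OF bij_shift, of "\<lambda>i. (cmod (coord x i))\<^sup>2" "- axis j 1"]
  by (simp add: norm_mult)

lemma adj_U_apply: "blinfun_apply (adj (U \<theta> j)) x = Ustar_fun \<theta> j x"
proof -
  have "bounded_linear (Ustar_fun \<theta> j)"
    by (rule bounded_linear_intro[where K = 1])
      (auto intro!: ell2_eqI simp: Ustar_fun.rep_eq algebra_simps norm_Ustar_fun)
  then have app: "blinfun_apply (Blinfun (Ustar_fun \<theta> j)) = Ustar_fun \<theta> j"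
    by (rule bounded_linear_Blinfun_apply)
  have "is_adjoint (Blinfun (Ustar_fun \<theta> j)) (U \<theta> j)"
    unfolding is_adjoint_def app U_apply
  proof (intro allI)
    fix x y
    have "cinner x (U_fun \<theta> j y) = (\<Sum>\<^sub>\<infinity>i. cnj (coord x i) * coord (U_fun \<theta> j y) i)"
      by (simp only: cinner_def)
    also have "\<dots> = (\<Sum>\<^sub>\<infinity>i. cnj (coord x (i + axis j 1)) * coord (U_fun \<theta> j y) (i + axis j 1))"
      using infsum_reindex_bij_betw[OF bij_shift,
          of "\<lambda>i. cnj (coord x i) * coord (U_fun \<theta> j y) i" "- axis j 1"] by simp
    also have "\<dots> = cinner (Ustar_fun \<theta> j x) y"
      by (simp add: cinner_def U_fun.rep_eq Ustar_fun.rep_eq mult_ac)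
    finally show "cinner (Ustar_fun \<theta> j x) y = cinner x (U_fun \<theta> j y)" by simp
  qed
  then show ?thesis by (simp add: adj_eqI app)
qed

lemma U_phase_shift:
  "U_phase \<theta> k (m - axis j 1) *
      (if j < k then exp (2 * of_real pi * \<i> * of_real (\<theta> $ k $ j)) else 1) = U_phase \<theta> k m"
proof -
  define d where "d = (if j < k then \<theta> $ k $ j else 0)"
  define c where "c = 2 * of_real pi * \<i>"
  define S where "S = (\<Sum>l | l < k. \<theta> $ k $ l * real_of_int (m $ l))"
  have "\<theta> $ k $ l * real_of_int ((m - axis j 1) $ l)
      = \<theta> $ k $ l * real_of_int (m $ l) - (if l = j then \<theta> $ k $ j else 0)" for l
    by (cases "l = j") (simp_all add: axis_def right_diff_distrib)
  then have "(\<Sum>l | l < k. \<theta> $ k $ l * real_of_int ((m - axis j 1) $ l)) = S - d"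
    by (simp add: sum_subtractf S_def d_def)
  moreover have "(if j < k then exp (c * of_real (\<theta> $ k $ j)) else 1) = exp (c * of_real d)"
    by (simp add: d_def)
  moreover have "exp (c * of_real (S - d)) * exp (c * of_real d) = exp (c * of_real S)"
    by (simp only: exp_add[symmetric] distrib_left[symmetric] of_real_add[symmetric] diff_add_cancel)
  ultimately show ?thesis
    unfolding U_phase_def c_def[symmetric] S_def[symmetric] by (simp only:)
qed

lemma U_commutation:
  fixes \<theta> :: "'n::{finite,linorder} rmat"
  assumes "transpose \<theta> = - \<theta>"
  shows "U \<theta> k o\<^sub>L U \<theta> j
    = scal (exp (2 * of_real pi * \<i> * of_real (\<theta> $ k $ j))) o\<^sub>L U \<theta> j o\<^sub>L U \<theta> k"
proof (rule blinfun_eqI, rule ell2_eqI)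
  fix x :: "'n zvec ell2" and m :: "'n zvec"
  have "\<theta> $ j $ k = transpose \<theta> $ k $ j"
    by (simp only: transpose_def vec_lambda_beta)
  then have sk: "\<theta> $ j $ k = - \<theta> $ k $ j"
    by (simp only: assms vector_uminus_component)
  define E E' where "E = exp (2 * of_real pi * \<i> * of_real (\<theta> $ k $ j))"
    and "E' = exp (2 * of_real pi * \<i> * of_real (\<theta> $ j $ k))"
  define m' where "m' = m - axis j 1 - axis k 1"
  have m'2: "m - axis k 1 - axis j 1 = m'"
    by (simp only: m'_def diff_diff_eq add.commute)
  have EE: "E * E' = 1"
    unfolding E_def E'_def sk
    by (simp only: exp_add[symmetric] distrib_left[symmetric] of_real_add[symmetric]
        add.right_inverse of_real_0 mult_zero_right exp_zero)
  have p1: "U_phase \<theta> k m' * (if j < k then E else 1) = U_phase \<theta> k (m - axis k 1)"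
    using U_phase_shift[of \<theta> k "m - axis k 1" j] unfolding m'2 E_def .
  have p2: "U_phase \<theta> j m' * (if k < j then E' else 1) = U_phase \<theta> j (m - axis j 1)"
    using U_phase_shift[of \<theta> j "m - axis j 1" k] unfolding m'_def[symmetric] E'_def .
  have "U_phase \<theta> k (m - axis k 1) * U_phase \<theta> j m' = E * (U_phase \<theta> j (m - axis j 1) * U_phase \<theta> k m')"
  proof (cases j k rule: linorder_cases)
    case equal
    then have "\<theta> $ k $ j = 0" using sk unfolding \<open>j = k\<close> by linarith
    then have "E = 1" by (simp add: E_def)
    with equal show ?thesis by simp
  next
    case less
    then have "\<not> k < j" by (rule less_not_sym)
    with less have "U_phase \<theta> k (m - axis k 1) = U_phase \<theta> k m' * E" "U_phase \<theta> j (m - axis j 1) = U_phase \<theta> j m'"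
      using p1 p2 by simp_all
    then show ?thesis by (simp only: mult_ac)
  next
    case greater
    then have "\<not> j < k" by (rule less_not_sym)
    with greater have "U_phase \<theta> k (m - axis k 1) = U_phase \<theta> k m'" "U_phase \<theta> j (m - axis j 1) = U_phase \<theta> j m' * E'"
      using p1 p2 by simp_all
    moreover have "E * (U_phase \<theta> j m' * E' * U_phase \<theta> k m') = (E * E') * (U_phase \<theta> k m' * U_phase \<theta> j m')"
      by (simp only: mult_ac)
    ultimately show ?thesis by (simp only: EE mult_1_left)
  qed
  then have "U_phase \<theta> k (m - axis k 1) * (U_phase \<theta> j m' * coord x m')
      = E * (U_phase \<theta> j (m - axis j 1) * (U_phase \<theta> k m' * coord x m'))"
    by (simp only: mult.assoc[symmetric])
  then show "coord (blinfun_apply (U \<theta> k o\<^sub>L U \<theta> j) x) m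
      = coord (blinfun_apply (scal (exp (2 * of_real pi * \<i> * of_real (\<theta> $ k $ j)))
          o\<^sub>L U \<theta> j o\<^sub>L U \<theta> k) x) m"
    by (simp only: blinfun_apply_blinfun_compose U_apply U_fun.rep_eq scal_apply scaleC.rep_eq
        m'2 m'_def[symmetric] E_def[symmetric])
qed

definition torus_Linf :: "'n::{finite,linorder} rmat \<Rightarrow> ('n::{finite,linorder} zvec) oper set"
  where "torus_Linf \<theta> = vN_generated (range (U \<theta>))"

text \<open>\<open>U\<^sub>1\<^bsup>m\<^sub>1\<^esup> \<cdots> U\<^sub>n\<^bsup>m\<^sub>n\<^esup>\<close>, the factors being ordered by the index.\<close>

definition Upow :: "'n::{finite,linorder} rmat \<Rightarrow> 'n::{finite,linorder} zvec \<Rightarrow> ('n::{finite,linorder} zvec) oper"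
  where "Upow \<theta> m =
    foldr (\<lambda>j T. unitary_powi (U \<theta> j) (m $ j) o\<^sub>L T) (sorted_list_of_set UNIV) id_blinfun"

lemma U_phase_eq_1: "(\<And>l. l < j \<Longrightarrow> m $ l = 0) \<Longrightarrow> U_phase \<theta> j m = 1"
  by (simp add: U_phase_def)

lemma adj_U_ket:
  "blinfun_apply (adj (U \<theta> j)) (ket m)
    = scaleC (cnj (U_phase \<theta> j (m - axis j 1))) (ket (m - axis j 1))"
  by (rule ell2_eqI) (auto simp: adj_U_apply Ustar_fun.rep_eq scaleC.rep_eq ket.rep_eq eq_diff_eq)

lemma scaleC_1: "scaleC 1 x = x"
  by (rule ell2_eqI) (simp add: scaleC.rep_eq)

lemma axis_0: "axis j (0 :: int) = 0"
  by (simp add: vec_eq_iff axis_def)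

lemma unitary_powi_U_ket:
  assumes "\<And>l. l < j \<Longrightarrow> m $ l = 0"
  shows "blinfun_apply (unitary_powi (U \<theta> j) z) (ket m) = ket (m + axis j z)"
proof -
  have ph: "U_phase \<theta> j (m + axis j y) = 1" for y
    by (rule U_phase_eq_1) (use assms in \<open>auto simp: axis_def\<close>)
  have ax: "axis j x + axis j y = axis j (x + y)" for x y :: int
    by (simp add: vec_eq_iff axis_def)
  have pos: "blinfun_apply ((((o\<^sub>L) (U \<theta> j)) ^^ p) id_blinfun) (ket m) = ket (m + axis j (int p))" for p
  proof (induction p)
    case (Suc p)
    have eq: "m + axis j (int p) + axis j 1 = m + axis j (int (Suc p))"
      by (simp add: vec_eq_iff axis_def)
    have "blinfun_apply ((((o\<^sub>L) (U \<theta> j)) ^^ Suc p) id_blinfun) (ket m)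
        = blinfun_apply (U \<theta> j) (ket (m + axis j (int p)))"
      by (simp add: Suc)
    also have "\<dots> = scaleC 1 (ket (m + axis j (int (Suc p))))"
      by (simp only: U_ket ph eq)
    finally show ?case by (simp only: scaleC_1)
  qed (simp add: axis_0)
  have neg: "blinfun_apply ((((o\<^sub>L) (adj (U \<theta> j))) ^^ p) id_blinfun) (ket m)
      = ket (m + axis j (- int p))" for p
  proof (induction p)
    case (Suc p)
    have eq: "m + axis j (- int p) - axis j 1 = m + axis j (- int (Suc p))"
      by (simp add: vec_eq_iff axis_def)
    have "blinfun_apply ((((o\<^sub>L) (adj (U \<theta> j))) ^^ Suc p) id_blinfun) (ket m)
        = blinfun_apply (adj (U \<theta> j)) (ket (m + axis j (- int p)))"
      by (simp add: Suc)
    also have "\<dots> = scaleC (cnj 1) (ket (m + axis j (- int (Suc p))))"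
      by (simp only: adj_U_ket ph eq)
    finally show ?case by (simp only: scaleC_1 complex_cnj_one)
  qed (simp add: axis_0)
  show ?thesis
    unfolding unitary_powi_def using pos[of "nat z"] neg[of "nat (- z)"] by auto
qed

lemma Upow_ket_0: "blinfun_apply (Upow \<theta> m) (ket 0) = ket m"
proof -
  have "blinfun_apply (foldr (\<lambda>j T. unitary_powi (U \<theta> j) (m $ j) o\<^sub>L T) xs id_blinfun) (ket 0)
      = ket (\<Sum>j\<in>set xs. axis j (m $ j))" if "sorted_wrt (<) xs" for xs
    using that
  proof (induction xs)
    case (Cons x xs)
    have "(\<Sum>j\<in>set xs. axis j (m $ j)) $ l = 0" if "l < x" for l
      using Cons.prems that by (auto simp: axis_def intro!: sum.neutral)
    moreover have "x \<notin> set xs" using Cons.prems by auto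
    ultimately show ?case
      using Cons by (simp add: unitary_powi_U_ket add.commute)
  qed simp
  from this[of "sorted_list_of_set UNIV"]
  have "blinfun_apply (Upow \<theta> m) (ket 0) = ket (\<Sum>j\<in>UNIV. axis j (m $ j))"
    by (simp add: Upow_def)
  also have "(\<Sum>j\<in>UNIV. axis j (m $ j)) = m"
    by (simp add: vec_eq_iff axis_def)
  finally show ?thesis .
qed

definition sq_norm :: "'n::{finite,linorder} zvec \<Rightarrow> real"
  where "sq_norm m = (\<Sum>j\<in>UNIV. (real_of_int (m $ j))\<^sup>2)"

definition rapidly_decreasing :: "('n::{finite,linorder} zvec \<Rightarrow> complex) \<Rightarrow> bool"
  where "rapidly_decreasing c \<longleftrightarrow> (\<forall>N::nat. \<exists>B. \<forall>m. (1 + sq_norm m) ^ N * cmod (c m) \<le> B)"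

definition torus_smooth :: "'n::{finite,linorder} rmat \<Rightarrow> ('n::{finite,linorder} zvec) oper set"
  where "torus_smooth \<theta> =
    {a. \<exists>c. rapidly_decreasing c \<and> ((\<lambda>m. scal (c m) o\<^sub>L Upow \<theta> m) has_sum a) UNIV}"

definition tau :: "('n::{finite,linorder} zvec) oper \<Rightarrow> complex"
  where "tau a = cinner (ket 0) (blinfun_apply a (ket 0))"

lemma tau_series:
  fixes \<theta> :: "'n::{finite,linorder} rmat"
  assumes "((\<lambda>m. scal (c m) o\<^sub>L Upow \<theta> m) has_sum a) UNIV"
  shows "tau a = c 0"
proof -
  have "bounded_linear (\<lambda>x :: 'n zvec ell2. coord x 0)"
    by (rule bounded_linear_intro[where K = 1]) (auto simp: scaleR_conv_of_real cmod_coord_le_norm)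
  then have "bounded_linear (\<lambda>T :: 'n zvec oper. coord (blinfun_apply T (ket 0)) 0)"
    using bounded_linear_compose[of "\<lambda>x :: 'n zvec ell2. coord x 0" "\<lambda>T :: 'n zvec oper. blinfun_apply T (ket 0)"]
      blinfun.bounded_linear_left by blast
  from has_sum_bounded_linear[OF this assms]
  have "((\<lambda>m. coord (blinfun_apply (scal (c m) o\<^sub>L Upow \<theta> m) (ket 0)) 0) has_sum tau a) UNIV"
    by (simp add: tau_def)
  moreover have "coord (blinfun_apply (scal (c m) o\<^sub>L Upow \<theta> m) (ket 0)) 0 = (if m = 0 then c 0 else 0)" for m
    by (simp add: Upow_ket_0 scaleC.rep_eq ket.rep_eq)
  ultimately have "((\<lambda>m :: 'n zvec. if m = 0 then c 0 else 0) has_sum tau a) UNIV"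
    by (simp only:)
  moreover have "((\<lambda>m :: 'n zvec. if m = 0 then c 0 else 0) has_sum c 0) UNIV"
    by (rule has_sum_finite_neutralI[of "{0}"]) auto
  ultimately show ?thesis by (rule has_sum_unique)
qed

text \<open>\<open>L\<^sup>2\<close> is the completion of the smooth algebra for \<open>\<tau>(|a|\<^sup>2)\<^bsup>1/2\<^esup>\<close>. As
  \<open>\<tau>(a\<^sup>*b) = \<langle>a e\<^sub>0, b e\<^sub>0\<rangle>\<close> (lemma \<open>tau_adj_mult\<close>), the map \<open>a \<mapsto> a e\<^sub>0\<close> is isometric
  for this norm, and the completion is realised as the closure of its image in the complete
  space \<open>\<ell>\<^sup>2(\<int>\<^sup>n)\<close>. The same map is the inclusion of \<open>L\<^sup>\<infinity>\<close> into \<open>L\<^sup>2\<close>.\<close>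

definition to_L2 :: "('n::{finite,linorder} zvec) oper \<Rightarrow> ('n::{finite,linorder} zvec) ell2"
  where "to_L2 a = blinfun_apply a (ket 0)"

lemma tau_adj_mult:
  assumes "is_adjoint a' a"
  shows "tau (a' o\<^sub>L b) = cinner (to_L2 a) (to_L2 b)"
proof -
  have "tau (a' o\<^sub>L b) = cnj (cinner (blinfun_apply a' (to_L2 b)) (ket 0))"
    unfolding tau_def to_L2_def by (subst cinner_commute) simp
  also have "\<dots> = cnj (cinner (to_L2 b) (to_L2 a))"
    using assms by (simp add: is_adjoint_def to_L2_def)
  also have "\<dots> = cinner (to_L2 a) (to_L2 b)"
    by (rule cinner_commute[symmetric])
  finally show ?thesis .
qed

definition torus_L2 :: "'n::{finite,linorder} rmat \<Rightarrow> ('n::{finite,linorder} zvec) ell2 set"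
  where "torus_L2 \<theta> = closure (to_L2 ` torus_smooth \<theta>)"

definition fourier :: "'n::{finite,linorder} rmat \<Rightarrow> ('n::{finite,linorder} zvec) ell2 \<Rightarrow> 'n::{finite,linorder} zvec \<Rightarrow> complex"
  where "fourier \<theta> \<xi> m = cinner (to_L2 (Upow \<theta> m)) \<xi>"

lemma fourier_to_L2:
  "is_adjoint w (Upow \<theta> m) \<Longrightarrow> fourier \<theta> (to_L2 a) m = tau (w o\<^sub>L a)"
  by (simp add: fourier_def tau_adj_mult)


section \<open>Sobolev spaces and noncommutative polynomials\<close>

definition sob_term :: "'n::{finite,linorder} rmat \<Rightarrow> real \<Rightarrow> ('n::{finite,linorder} zvec) ell2 \<Rightarrow> 'n::{finite,linorder} zvec \<Rightarrow> real"
  where "sob_term \<theta> s \<xi> m = (1 + 4 * pi\<^sup>2 * sq_norm m) powr s * (cmod (fourier \<theta> \<xi> m))\<^sup>2"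

definition Sob :: "'n::{finite,linorder} rmat \<Rightarrow> real \<Rightarrow> ('n::{finite,linorder} zvec) ell2 set"
  where "Sob \<theta> s = {\<xi> \<in> torus_L2 \<theta>. sob_term \<theta> s \<xi> summable_on UNIV}"

definition sob_norm :: "'n::{finite,linorder} rmat \<Rightarrow> real \<Rightarrow> ('n::{finite,linorder} zvec) ell2 \<Rightarrow> real"
  where "sob_norm \<theta> s \<xi> = sqrt (\<Sum>\<^sub>\<infinity>m. sob_term \<theta> s \<xi> m)"

text \<open>The element of \<open>L\<^sup>\<infinity>\<close> represented by a vector of \<open>L\<^sup>2\<close>; it is unique because \<open>e\<^sub>0\<close> is
  separating for \<open>L\<^sup>\<infinity>\<close>, and it exists for vectors in \<open>Sob \<theta> k\<close>, \<open>k > n/2\<close>.\<close>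

definition Linf_of :: "'n::{finite,linorder} rmat \<Rightarrow> ('n::{finite,linorder} zvec) ell2 \<Rightarrow> ('n::{finite,linorder} zvec) oper"
  where "Linf_of \<theta> \<xi> = (THE a. a \<in> torus_Linf \<theta> \<and> to_L2 a = \<xi>)"

text \<open>\<open>nc_monomial \<beta> u \<nu> = \<beta>\<^sub>0 u \<beta>\<^sub>1 u \<cdots> u \<beta>\<^sub>\<nu>\<close>\<close>

primrec nc_monomial :: "(nat \<Rightarrow> 'i oper) \<Rightarrow> 'i oper \<Rightarrow> nat \<Rightarrow> 'i oper"
  where
    "nc_monomial \<beta> u 0 = \<beta> 0"
  | "nc_monomial \<beta> u (Suc \<nu>) = nc_monomial \<beta> u \<nu> o\<^sub>L u o\<^sub>L \<beta> (Suc \<nu>)"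

definition nc_poly ::
  "'n::{finite,linorder} rmat \<Rightarrow> nat \<Rightarrow> (nat \<Rightarrow> nat) \<Rightarrow> (nat \<Rightarrow> nat \<Rightarrow> nat \<Rightarrow> ('n::{finite,linorder} zvec) ell2)
     \<Rightarrow> ('n::{finite,linorder} zvec) ell2 \<Rightarrow> ('n::{finite,linorder} zvec) ell2"
  where "nc_poly \<theta> q N b u =
    to_L2 (\<Sum>\<nu>=0..q. \<Sum>\<mu>=1..N \<nu>. nc_monomial (\<lambda>i. Linf_of \<theta> (b \<nu> \<mu> i)) (Linf_of \<theta> u) \<nu>)"

text \<open>Self-maps of a space \<open>X\<close> normed by \<open>nrm\<close>.\<close>

definition locally_lipschitz :: "'a::ab_group_add set \<Rightarrow> ('a \<Rightarrow> real) \<Rightarrow> ('a \<Rightarrow> 'a) \<Rightarrow> bool"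
  where "locally_lipschitz X nrm F \<longleftrightarrow> F ` X \<subseteq> X \<and>
    (\<forall>R>0. \<exists>L. \<forall>u\<in>X. \<forall>v\<in>X. nrm u \<le> R \<longrightarrow> nrm v \<le> R \<longrightarrow> nrm (F u - F v) \<le> L * nrm (u - v))"

end

theory Submission
  imports Defs
begin

text \<open>Right multiplication by \<open>U\<^sup>l\<close> is a unitary of \<open>\<ell>\<^sup>2(\<int>\<^sup>n)\<close> that commutes with every \<open>U\<^sub>j\<close> and
  moves \<open>e\<^sub>0\<close> to \<open>e\<^sub>l\<close>. Hence an element of \<open>L\<^sup>\<infinity>\<close> is determined by its image of \<open>e\<^sub>0\<close>, and the
  Fourier coefficients of a product are a convolution twisted by phases of modulus one. By
  Cauchy-Schwarz \<open>H\<^sup>k\<close> embeds into the absolutely convergent Fourier series when \<open>k > n/2\<close>, so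
  splitting the Sobolev weight between the two factors and applying Young's inequality shows that
  \<open>H\<^sup>k\<close> is a Banach algebra up to a constant. Both estimates for \<open>\<P>\<close> then follow by telescoping.\<close>

section \<open>Square-summable families\<close>

lemma bounded_linear_coord: "bounded_linear (\<lambda>x. coord x i)"
  by (rule bounded_linear_intro[where K = 1]) (auto simp: scaleR_conv_of_real cmod_coord_le_norm)

lemma bounded_linear_scaleC: "bounded_linear (scaleC c)"
  using blinfun.bounded_linear_right[of "scal c"] by simp

lemma coord_sum: "coord (sum f F) i = (\<Sum>j\<in>F. coord (f j) i)"
  by (induction F rule: infinite_finite_induct) auto

text \<open>By orthogonality, the squared distance from \<open>x\<close> to the partial sum over
  \<open>F\<close> is the part of the squared norm lying outside \<open>F\<close>, which tends to
  0.\<close>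

lemma has_sum_ket:
  fixes x :: "'i ell2"
  shows "((\<lambda>i. scaleC (coord x i) (ket i)) has_sum x) UNIV"
proof -
  let ?S = "\<lambda>F. \<Sum>i\<in>F. scaleC (coord x i) (ket i)"
  have "(norm (x - ?S F))\<^sup>2 = (norm x)\<^sup>2 - (\<Sum>i\<in>F. (cmod (coord x i))\<^sup>2)" if "finite F" for F
  proof -
    have c: "coord (x - ?S F) i = (if i \<in> F then 0 else coord x i)" for i
      by (simp add: coord_sum scaleC.rep_eq ket.rep_eq if_distrib that cong: if_cong)
    have "(norm (x - ?S F))\<^sup>2 = infsum (\<lambda>i. (cmod (coord x i))\<^sup>2) (UNIV - F)"
      unfolding norm_ell2_sq c by (rule infsum_cong_neutral) auto
    also have "\<dots> = infsum (\<lambda>i. (cmod (coord x i))\<^sup>2) UNIV - infsum (\<lambda>i. (cmod (coord x i))\<^sup>2) F"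
      by (rule infsum_Diff) (use that in \<open>auto intro: coord_summable\<close>)
    finally show ?thesis
      using that by (simp add: norm_ell2_sq)
  qed
  moreover have "((\<lambda>F. (norm x)\<^sup>2 - (\<Sum>i\<in>F. (cmod (coord x i))\<^sup>2)) \<longlongrightarrow> (norm x)\<^sup>2 - (norm x)\<^sup>2)
      (finite_subsets_at_top UNIV)"
    unfolding norm_ell2_sq
    by (intro tendsto_diff tendsto_const infsum_tendsto coord_summable)
  ultimately have "((\<lambda>F. (norm (x - ?S F))\<^sup>2) \<longlongrightarrow> 0) (finite_subsets_at_top UNIV)"
    by (subst tendsto_cong[where g = "\<lambda>F. (norm x)\<^sup>2 - (\<Sum>i\<in>F. (cmod (coord x i))\<^sup>2)"])
      (auto intro: eventually_finite_subsets_at_top_weakI)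
  from tendsto_real_sqrt[OF this]
  have "((\<lambda>F. norm (?S F - x)) \<longlongrightarrow> 0) (finite_subsets_at_top UNIV)"
    by (simp add: norm_minus_commute)
  then have "((\<lambda>F. ?S F - x) \<longlongrightarrow> 0) (finite_subsets_at_top UNIV)"
    by (rule tendsto_norm_zero_cancel)
  then show ?thesis
    unfolding has_sum_def by (rule LIM_zero_cancel)
qed

lemma clinear_ops_has_sum:
  assumes "a \<in> clinear_ops"
  shows "((\<lambda>i. scaleC (coord x i) (blinfun_apply a (ket i))) has_sum blinfun_apply a x) UNIV"
  using has_sum_bounded_linear[OF blinfun.bounded_linear_right has_sum_ket, of a x] assms
  by (simp add: clinear_ops_def)

text \<open>The expansion in kets has complex coefficients, so complex linearity together with
  continuity makes the values on the kets decisive.\<close>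

lemma clinear_ops_eqI:
  assumes "a \<in> clinear_ops" "a' \<in> clinear_ops"
    and "\<And>i. blinfun_apply a (ket i) = blinfun_apply a' (ket i)"
  shows "a = a'"
proof (rule blinfun_eqI)
  fix x
  show "blinfun_apply a x = blinfun_apply a' x"
    using clinear_ops_has_sum[OF assms(1), of x] clinear_ops_has_sum[OF assms(2), of x]
    unfolding assms(3) by (rule has_sum_unique)
qed

text \<open>Young's inequality \<open>\<ell>\<^sup>1 * \<ell>\<^sup>2 \<subseteq> \<ell>\<^sup>2\<close>: the convolution is an absolutely convergent
  series of translates of \<open>g\<close> in the Banach space \<open>\<ell>\<^sup>2\<close>.\<close>

lemma young_l1_l2:
  fixes f g :: "'i::ab_group_add \<Rightarrow> real"
  assumes f: "f summable_on UNIV" "\<And>l. 0 \<le> f l" and g: "(\<lambda>l. (g l)\<^sup>2) summable_on UNIV"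
  shows "(\<lambda>l. f l * g (m - l)) summable_on UNIV"
    and "(\<lambda>m. (\<Sum>\<^sub>\<infinity>l. f l * g (m - l))\<^sup>2) summable_on UNIV"
    and "sqrt (\<Sum>\<^sub>\<infinity>m. (\<Sum>\<^sub>\<infinity>l. f l * g (m - l))\<^sup>2) \<le> (\<Sum>\<^sub>\<infinity>l. f l) * sqrt (\<Sum>\<^sub>\<infinity>l. (g l)\<^sup>2)"
proof -
  define t where "t l = Abs_ell2 (\<lambda>m. complex_of_real (g (m - l)))" for l
  have "(\<lambda>m. (cmod (complex_of_real (g (m - l))))\<^sup>2) summable_on UNIV" for l
    using summable_on_reindex_bij_betw[OF bij_shift, of "\<lambda>i. (g i)\<^sup>2" l] g by simp
  then have ct: "coord (t l) = (\<lambda>m. complex_of_real (g (m - l)))" for l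
    by (simp add: t_def Abs_ell2_inverse)
  have nt: "norm (t l) = sqrt (\<Sum>\<^sub>\<infinity>l. (g l)\<^sup>2)" for l
    using infsum_reindex_bij_betw[OF bij_shift, of "\<lambda>i. (g i)\<^sup>2" l] by (simp add: norm_ell2_def ct)
  have nf: "norm (f l *\<^sub>R t l) = f l * sqrt (\<Sum>\<^sub>\<infinity>l. (g l)\<^sup>2)" for l
    by (simp add: nt f(2))
  have abs: "(\<lambda>l. f l *\<^sub>R t l) abs_summable_on UNIV"
    unfolding nf by (rule summable_on_cmult_left[OF f(1)])
  define h where "h = (\<Sum>\<^sub>\<infinity>l. f l *\<^sub>R t l)"
  have "((\<lambda>l. f l *\<^sub>R t l) has_sum h) UNIV"
    unfolding h_def by (rule has_sum_infsum, rule abs_summable_summable, rule abs)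
  from has_sum_bounded_linear[OF bounded_linear_coord this]
  have *: "((\<lambda>l. complex_of_real (f l * g (m - l))) has_sum coord h m) UNIV" for m
    by (simp add: ct)
  have h: "((\<lambda>l. f l * g (m - l)) has_sum Re (coord h m)) UNIV" for m
    using has_sum_Re[OF *[of m]] by simp
  then show "(\<lambda>l. f l * g (m - l)) summable_on UNIV"
    by (rule has_sum_imp_summable)
  have inf: "(\<Sum>\<^sub>\<infinity>l. f l * g (m - l)) = Re (coord h m)" for m
    using h by (rule infsumI)
  \<comment> \<open>\<open>coord h m\<close> is the sum of a real series, so nothing is lost in
    passing to its real part.\<close>
  have "complex_of_real (Re (coord h m)) = coord h m" for m
    using has_sum_unique[OF has_sum_of_real[OF h] *] .
  then have cm: "(cmod (coord h m))\<^sup>2 = (\<Sum>\<^sub>\<infinity>l. f l * g (m - l))\<^sup>2" for m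
    unfolding inf by (metis norm_of_real power2_abs)
  show "(\<lambda>m. (\<Sum>\<^sub>\<infinity>l. f l * g (m - l))\<^sup>2) summable_on UNIV"
    using coord_summable[of h] unfolding cm .
  have "norm h \<le> (\<Sum>\<^sub>\<infinity>l. norm (f l *\<^sub>R t l))"
    unfolding h_def by (rule norm_infsum_bound[OF abs])
  also have "\<dots> = (\<Sum>\<^sub>\<infinity>l. f l) * sqrt (\<Sum>\<^sub>\<infinity>l. (g l)\<^sup>2)"
    unfolding nf by (rule infsum_cmult_left')
  finally show "sqrt (\<Sum>\<^sub>\<infinity>m. (\<Sum>\<^sub>\<infinity>l. f l * g (m - l))\<^sup>2) \<le> (\<Sum>\<^sub>\<infinity>l. f l) * sqrt (\<Sum>\<^sub>\<infinity>l. (g l)\<^sup>2)"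
    unfolding norm_ell2_def cm .
qed

lemma cauchy_schwarz_infsum:
  fixes f g :: "'i \<Rightarrow> real"
  assumes f: "(\<lambda>i. (f i)\<^sup>2) summable_on UNIV" and g: "(\<lambda>i. (g i)\<^sup>2) summable_on UNIV"
  shows "(\<lambda>i. \<bar>f i * g i\<bar>) summable_on UNIV"
    and "(\<Sum>\<^sub>\<infinity>i. \<bar>f i * g i\<bar>) \<le> sqrt (\<Sum>\<^sub>\<infinity>i. (f i)\<^sup>2) * sqrt (\<Sum>\<^sub>\<infinity>i. (g i)\<^sup>2)"
proof -
  have *: "(\<Sum>i\<in>F. \<bar>f i * g i\<bar>) \<le> sqrt (\<Sum>\<^sub>\<infinity>i. (f i)\<^sup>2) * sqrt (\<Sum>\<^sub>\<infinity>i. (g i)\<^sup>2)" if "finite F" for F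
  proof -
    have "(\<Sum>i\<in>F. \<bar>f i * g i\<bar>) \<le> L2_set f F * L2_set g F"
      unfolding abs_mult by (rule L2_set_mult_ineq)
    also have "\<dots> \<le> sqrt (\<Sum>\<^sub>\<infinity>i. (f i)\<^sup>2) * sqrt (\<Sum>\<^sub>\<infinity>i. (g i)\<^sup>2)"
      unfolding L2_set_def
      by (intro mult_mono real_sqrt_le_mono finite_sum_le_infsum)
        (use that f g in \<open>auto intro: sum_nonneg infsum_nonneg\<close>)
    finally show ?thesis .
  qed
  show s: "(\<lambda>i. \<bar>f i * g i\<bar>) summable_on UNIV"
    by (rule nonneg_bdd_above_summable_on)
      (auto intro!: bdd_aboveI2[where M = "sqrt (\<Sum>\<^sub>\<infinity>i. (f i)\<^sup>2) * sqrt (\<Sum>\<^sub>\<infinity>i. (g i)\<^sup>2)"] *)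
  show "(\<Sum>\<^sub>\<infinity>i. \<bar>f i * g i\<bar>) \<le> sqrt (\<Sum>\<^sub>\<infinity>i. (f i)\<^sup>2) * sqrt (\<Sum>\<^sub>\<infinity>i. (g i)\<^sup>2)"
    by (rule infsum_le_finite_sums[OF s]) (use * in auto)
qed


section \<open>Commutants\<close>

lemma blinfun_compose_assoc: "(S o\<^sub>L T) o\<^sub>L V = S o\<^sub>L (T o\<^sub>L V)"
  by (rule blinfun_eqI) simp

lemma blinfun_compose_id [simp]: "id_blinfun o\<^sub>L T = T" "T o\<^sub>L id_blinfun = T"
  by (auto intro: blinfun_eqI)

lemma clinear_ops_id: "id_blinfun \<in> clinear_ops"
  by (simp add: clinear_ops_def)

lemma clinear_ops_compose: "S \<in> clinear_ops \<Longrightarrow> T \<in> clinear_ops \<Longrightarrow> S o\<^sub>L T \<in> clinear_ops"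
  by (simp add: clinear_ops_def)

lemma clinear_ops_has_sum_closed:
  assumes "(f has_sum T) I" "\<And>i. i \<in> I \<Longrightarrow> f i \<in> clinear_ops"
  shows "T \<in> clinear_ops"
  unfolding clinear_ops_def
proof (intro CollectI allI)
  fix c x
  have 1: "((\<lambda>i. blinfun_apply (f i) y) has_sum blinfun_apply T y) I" for y
    by (rule has_sum_bounded_linear[OF blinfun.bounded_linear_left assms(1)])
  have "((\<lambda>i. scaleC c (blinfun_apply (f i) x)) has_sum scaleC c (blinfun_apply T x)) I"
    by (rule has_sum_bounded_linear[OF bounded_linear_scaleC 1])
  also have "?this \<longleftrightarrow> ((\<lambda>i. blinfun_apply (f i) (scaleC c x)) has_sum scaleC c (blinfun_apply T x)) I"
    by (rule has_sum_cong) (use assms(2) in \<open>auto simp: clinear_ops_def\<close>)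
  finally show "blinfun_apply T (scaleC c x) = scaleC c (blinfun_apply T x)"
    by (rule has_sum_unique[OF 1])
qed

lemma commutant_clinear: "T \<in> commutant M \<Longrightarrow> T \<in> clinear_ops"
  by (simp add: commutant_def)

lemma commutant_id: "id_blinfun \<in> commutant M"
  by (auto simp: commutant_def clinear_ops_id intro: blinfun_eqI)

lemma commutant_compose:
  assumes "S \<in> commutant M" "T \<in> commutant M"
  shows "S o\<^sub>L T \<in> commutant M"
proof -
  have "(S o\<^sub>L T) o\<^sub>L A = A o\<^sub>L (S o\<^sub>L T)" if "A \<in> M" for A
  proof -
    have "S o\<^sub>L A = A o\<^sub>L S" "T o\<^sub>L A = A o\<^sub>L T"
      using assms that by (auto simp: commutant_def)
    then show ?thesis
      by (simp only: blinfun_compose_assoc) (simp only: blinfun_compose_assoc[symmetric])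
  qed
  then show ?thesis
    using assms by (simp add: commutant_def clinear_ops_compose)
qed

text \<open>Composition with a fixed operator is continuous in either argument. The index set is
  arbitrary, so that Fourier series, two-term sums and the empty sum are all covered.\<close>

lemma commutant_has_sum_closed:
  assumes "(f has_sum T) I" "\<And>i. i \<in> I \<Longrightarrow> f i \<in> commutant M"
  shows "T \<in> commutant M"
proof -
  have "T o\<^sub>L A = A o\<^sub>L T" if "A \<in> M" for A
  proof -
    have "((\<lambda>i. f i o\<^sub>L A) has_sum (T o\<^sub>L A)) I"
      by (rule has_sum_bounded_linear[OF bounded_bilinear.bounded_linear_left[OF bounded_bilinear_blinfun_compose] assms(1)])
    also have "?this \<longleftrightarrow> ((\<lambda>i. A o\<^sub>L f i) has_sum (T o\<^sub>L A)) I"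
      by (rule has_sum_cong) (use assms(2) that in \<open>auto simp: commutant_def\<close>)
    finally show ?thesis
      using has_sum_bounded_linear[OF bounded_bilinear.bounded_linear_right[OF bounded_bilinear_blinfun_compose] assms(1)]
      by (rule has_sum_unique)
  qed
  moreover have "T \<in> clinear_ops"
    by (rule clinear_ops_has_sum_closed[OF assms(1)]) (use assms(2) in \<open>auto simp: commutant_def\<close>)
  ultimately show ?thesis
    by (simp add: commutant_def)
qed

lemma commutant_0: "0 \<in> commutant M"
  by (rule commutant_has_sum_closed[where I = "{}"]) (auto intro: has_sum_empty)

lemma commutant_add: "S \<in> commutant M \<Longrightarrow> T \<in> commutant M \<Longrightarrow> S + T \<in> commutant M"
  using commutant_has_sum_closed[of "\<lambda>b. if b then S else T" UNIV "S + T" M]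
  by (simp add: has_sum_finite_iff UNIV_bool add.commute)

lemma commutant_scal:
  assumes "\<And>A. A \<in> M \<Longrightarrow> A \<in> clinear_ops"
  shows "scal c \<in> commutant M"
proof -
  have "scal c \<in> clinear_ops"
    by (auto simp: clinear_ops_def scaleC.rep_eq mult_ac intro!: ell2_eqI)
  then show ?thesis
    using assms by (auto simp: commutant_def clinear_ops_def intro!: blinfun_eqI)
qed

lemma scaleR_eq_scaleC: "r *\<^sub>R x = scaleC (of_real r) x"
  by (rule ell2_eqI) (simp add: scaleC.rep_eq)

lemma scal_of_real_compose: "scal (of_real r) o\<^sub>L T = r *\<^sub>R T"
  by (rule blinfun_eqI) (simp add: scaleR_eq_scaleC blinfun.scaleR_left)

lemma norm_scal_le: "norm (scal c) \<le> cmod c"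
  by (rule norm_blinfun_bound) (simp_all add: norm_scaleC)

lemma subset_bicommutant:
  assumes "M \<subseteq> clinear_ops"
  shows "M \<subseteq> commutant (commutant M)"
  using assms by (auto simp: commutant_def)


section \<open>Right translations\<close>

text \<open>\<open>rphase \<theta> m l\<close> is the scalar in \<open>U\<^sup>m U\<^sup>l = rphase \<theta> m l \<cdot> U\<^bsup>m+l\<^esup>\<close>, so that
  \<open>rtrans \<theta> l\<close> is right multiplication by \<open>U\<^sup>l\<close> on \<open>\<ell>\<^sup>2\<close>.\<close>

definition rphase :: "'n::{finite,linorder} rmat \<Rightarrow> 'n zvec \<Rightarrow> 'n zvec \<Rightarrow> complex"
  where "rphase \<theta> m l = exp (2 * of_real pi * \<i> *
    of_real (\<Sum>j\<in>UNIV. real_of_int (m $ j) * (\<Sum>i | i < j. \<theta> $ j $ i * real_of_int (l $ i))))"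

lemma norm_rphase [simp]: "cmod (rphase \<theta> m l) = 1"
  by (simp add: rphase_def)

lemma rphase_0 [simp]: "rphase \<theta> 0 l = 1"
  by (simp add: rphase_def)

lemma rphase_add: "rphase \<theta> (m + m') l = rphase \<theta> m l * rphase \<theta> m' l"
  by (simp add: rphase_def distrib_left distrib_right sum.distrib exp_add)

text \<open>A unit vector in the first argument selects row \<open>j\<close> of the exponent. This
  ties the phase of right translations to the phase in the definition of \<open>U\<close>.\<close>

lemma rphase_axis: "rphase \<theta> (axis j 1) l = U_phase \<theta> j l"
proof -
  have "(\<Sum>i\<in>UNIV. real_of_int (axis j 1 $ i) * f i) = f j" for f
    by (subst sum.remove[of _ j]) (auto simp: axis_def intro!: sum.neutral)
  then show ?thesis
    by (simp add: rphase_def U_phase_def)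
qed

lemma U_phase_add: "U_phase \<theta> j (m + m') = U_phase \<theta> j m * U_phase \<theta> j m'"
  by (simp add: U_phase_def distrib_left distrib_right sum.distrib exp_add)

lift_definition rtrans_fun :: "'n::{finite,linorder} rmat \<Rightarrow> 'n zvec \<Rightarrow> 'n zvec ell2 \<Rightarrow> 'n zvec ell2"
  is "\<lambda>\<theta> l f m. rphase \<theta> (m - l) l * f (m - l)"
  subgoal for \<theta> l f
    using summable_on_reindex_bij_betw[OF bij_shift, of "\<lambda>i. (cmod (f i))\<^sup>2" l]
    by (simp add: norm_mult)
  done

definition rtrans :: "'n::{finite,linorder} rmat \<Rightarrow> 'n zvec \<Rightarrow> 'n zvec oper"
  where "rtrans \<theta> l = Blinfun (rtrans_fun \<theta> l)"

lemma norm_rtrans_fun: "norm (rtrans_fun \<theta> l x) = norm x"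
  unfolding norm_ell2_def rtrans_fun.rep_eq
  using infsum_reindex_bij_betw[OF bij_shift, of "\<lambda>i. (cmod (coord x i))\<^sup>2" l]
  by (simp add: norm_mult)

lemma rtrans_apply: "blinfun_apply (rtrans \<theta> l) x = rtrans_fun \<theta> l x"
proof -
  have "bounded_linear (rtrans_fun \<theta> l)"
    by (rule bounded_linear_intro[where K = 1])
      (auto intro!: ell2_eqI simp: rtrans_fun.rep_eq algebra_simps norm_rtrans_fun)
  then show ?thesis by (simp add: rtrans_def bounded_linear_Blinfun_apply)
qed

lemma coord_rtrans: "coord (blinfun_apply (rtrans \<theta> l) x) m = rphase \<theta> (m - l) l * coord x (m - l)"
  by (simp add: rtrans_apply rtrans_fun.rep_eq)

lemma rtrans_ket_0: "blinfun_apply (rtrans \<theta> l) (ket 0) = ket l"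
  by (rule ell2_eqI) (simp add: coord_rtrans ket.rep_eq)

lemma coord_U: "coord (blinfun_apply (U \<theta> j) x) m = U_phase \<theta> j (m - axis j 1) * coord x (m - axis j 1)"
  by (simp add: U_apply U_fun.rep_eq)

text \<open>Both orders shift the index by \<open>l\<close> and by the unit vector. Since both
  phases are additive characters of the index, each order collects the same factors
  \<open>rphase \<theta> m' l\<close>, \<open>U_phase \<theta> j m'\<close> and
  \<open>U_phase \<theta> j l\<close>.\<close>

lemma rtrans_U_commute: "rtrans \<theta> l o\<^sub>L U \<theta> j = U \<theta> j o\<^sub>L rtrans \<theta> l"
proof (rule blinfun_eqI, rule ell2_eqI)
  fix x m
  define m' where "m' = m - l - axis j 1"
  have m: "m - l = m' + axis j 1" "m - axis j 1 = m' + l" "m' + axis j 1 - axis j 1 = m'" "m' + l - l = m'"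
    by (simp_all add: m'_def)
  show "coord (blinfun_apply (rtrans \<theta> l o\<^sub>L U \<theta> j) x) m = coord (blinfun_apply (U \<theta> j o\<^sub>L rtrans \<theta> l) x) m"
    by (simp only: blinfun_apply_blinfun_compose coord_rtrans coord_U m rphase_add rphase_axis U_phase_add mult_ac)
qed

lemma U_adj_compose: "U \<theta> j o\<^sub>L adj (U \<theta> j) = id_blinfun" "adj (U \<theta> j) o\<^sub>L U \<theta> j = id_blinfun"
proof -
  have "cnj (U_phase \<theta> j m) * U_phase \<theta> j m = 1" for m
    using complex_norm_square[of "U_phase \<theta> j m"] by (simp add: mult.commute)
  then show "U \<theta> j o\<^sub>L adj (U \<theta> j) = id_blinfun" "adj (U \<theta> j) o\<^sub>L U \<theta> j = id_blinfun"
    by (auto intro!: blinfun_eqI ell2_eqI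
        simp: adj_U_apply U_apply U_fun.rep_eq Ustar_fun.rep_eq mult.assoc[symmetric] mult.commute[of _ "cnj _"])
qed

lemma rtrans_adj_U_commute: "rtrans \<theta> l o\<^sub>L adj (U \<theta> j) = adj (U \<theta> j) o\<^sub>L rtrans \<theta> l"
proof -
  \<comment> \<open>Multiplying the relation for \<open>U \<theta> j\<close> by its inverse from
    both sides turns it into the relation for the adjoint.\<close>
  have "adj (U \<theta> j) o\<^sub>L (U \<theta> j o\<^sub>L rtrans \<theta> l) o\<^sub>L adj (U \<theta> j)
      = adj (U \<theta> j) o\<^sub>L (rtrans \<theta> l o\<^sub>L U \<theta> j) o\<^sub>L adj (U \<theta> j)"
    by (simp only: rtrans_U_commute)
  then have "(adj (U \<theta> j) o\<^sub>L U \<theta> j) o\<^sub>L rtrans \<theta> l o\<^sub>L adj (U \<theta> j)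
      = adj (U \<theta> j) o\<^sub>L rtrans \<theta> l o\<^sub>L (U \<theta> j o\<^sub>L adj (U \<theta> j))"
    by (simp only: blinfun_compose_assoc)
  then show ?thesis
    by (simp add: U_adj_compose)
qed

text \<open>Elements of \<open>torus_Linf \<theta>\<close> lie in the commutant of this commutant
  and therefore commute with all right translations.\<close>

lemma rtrans_commutant: "rtrans \<theta> l \<in> commutant (range (U \<theta>) \<union> adj ` range (U \<theta>))"
  by (auto simp: commutant_def clinear_ops_def rtrans_U_commute rtrans_adj_U_commute
      coord_rtrans scaleC.rep_eq intro!: ell2_eqI)

lemma U_clinear: "range (U \<theta>) \<union> adj ` range (U \<theta>) \<subseteq> clinear_ops"
  by (auto simp: clinear_ops_def U_apply adj_U_apply U_fun.rep_eq Ustar_fun.rep_eq scaleC.rep_eq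
      intro!: ell2_eqI)

section \<open>Elements of L^infty and their action on e_0\<close>

lemma torus_Linf_clinear: "a \<in> torus_Linf \<theta> \<Longrightarrow> a \<in> clinear_ops"
  unfolding torus_Linf_def vN_generated_def by (rule commutant_clinear)

lemma U_in_torus_Linf: "U \<theta> j \<in> torus_Linf \<theta>" "adj (U \<theta> j) \<in> torus_Linf \<theta>"
  unfolding torus_Linf_def vN_generated_def using subset_bicommutant[OF U_clinear] by blast+

lemma torus_Linf_compose: "a \<in> torus_Linf \<theta> \<Longrightarrow> b \<in> torus_Linf \<theta> \<Longrightarrow> a o\<^sub>L b \<in> torus_Linf \<theta>"
  unfolding torus_Linf_def vN_generated_def by (rule commutant_compose)

lemma torus_Linf_has_sum_closed:
  "(f has_sum a) I \<Longrightarrow> (\<And>i. i \<in> I \<Longrightarrow> f i \<in> torus_Linf \<theta>) \<Longrightarrow> a \<in> torus_Linf \<theta>"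
  unfolding torus_Linf_def vN_generated_def by (rule commutant_has_sum_closed)

lemma torus_Linf_add: "a \<in> torus_Linf \<theta> \<Longrightarrow> b \<in> torus_Linf \<theta> \<Longrightarrow> a + b \<in> torus_Linf \<theta>"
  unfolding torus_Linf_def vN_generated_def by (rule commutant_add)

lemma torus_Linf_0: "0 \<in> torus_Linf \<theta>"
  unfolding torus_Linf_def vN_generated_def by (rule commutant_0)

lemma torus_Linf_scal: "scal c \<in> torus_Linf \<theta>"
  unfolding torus_Linf_def vN_generated_def by (rule commutant_scal, rule commutant_clinear)

lemma torus_Linf_diff:
  assumes "a \<in> torus_Linf \<theta>" "b \<in> torus_Linf \<theta>"
  shows "a - b \<in> torus_Linf \<theta>"
  using torus_Linf_add[OF assms(1) torus_Linf_compose[OF torus_Linf_scal[of "of_real (-1)"] assms(2)]]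
  by (simp only: scal_of_real_compose) simp

text \<open>The norm bound is proved along with membership because both pass to \<open>Upow\<close>,
  where the bound makes Fourier series converge in operator norm.\<close>

lemma
  shows unitary_powi_in_torus_Linf: "unitary_powi (U \<theta> j) z \<in> torus_Linf \<theta>"
    and norm_unitary_powi_le: "norm (unitary_powi (U \<theta> j) z) \<le> 1"
proof -
  have *: "(((o\<^sub>L) V) ^^ p) id_blinfun \<in> torus_Linf \<theta> \<and> norm ((((o\<^sub>L) V) ^^ p) id_blinfun) \<le> 1"
    if "V \<in> torus_Linf \<theta>" "norm V \<le> 1" for V p
  proof (induction p)
    case 0
    show ?case
      unfolding torus_Linf_def vN_generated_def
      by (auto intro!: commutant_id norm_blinfun_bound)
  next
    case (Suc p)
    then show ?case
      using that norm_blinfun_compose[of V "(((o\<^sub>L) V) ^^ p) id_blinfun"]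
      by (auto intro: torus_Linf_compose order_trans[OF _ mult_le_one])
  qed
  have "norm (U \<theta> j) \<le> 1" "norm (adj (U \<theta> j)) \<le> 1"
    by (rule norm_blinfun_bound; simp add: U_apply adj_U_apply norm_U_fun norm_Ustar_fun)+
  then show "unitary_powi (U \<theta> j) z \<in> torus_Linf \<theta>" "norm (unitary_powi (U \<theta> j) z) \<le> 1"
    unfolding unitary_powi_def
    using *[OF U_in_torus_Linf(1)] *[OF U_in_torus_Linf(2)] by auto
qed

lemma
  shows Upow_in_torus_Linf: "Upow \<theta> m \<in> torus_Linf \<theta>"
    and norm_Upow_le: "norm (Upow \<theta> m) \<le> 1"
proof -
  have "foldr (\<lambda>j T. unitary_powi (U \<theta> j) (m $ j) o\<^sub>L T) js id_blinfun \<in> torus_Linf \<theta>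
      \<and> norm (foldr (\<lambda>j T. unitary_powi (U \<theta> j) (m $ j) o\<^sub>L T) js id_blinfun) \<le> 1" for js
  proof (induction js)
    case Nil
    show ?case
      unfolding torus_Linf_def vN_generated_def
      by (auto intro!: commutant_id norm_blinfun_bound)
  next
    case (Cons j js)
    then show ?case
      by (auto intro!: torus_Linf_compose unitary_powi_in_torus_Linf
          order_trans[OF norm_blinfun_compose] mult_le_one norm_unitary_powi_le)
  qed
  then show "Upow \<theta> m \<in> torus_Linf \<theta>" "norm (Upow \<theta> m) \<le> 1"
    unfolding Upow_def by auto
qed

text \<open>\<open>rtrans \<theta> l\<close> carries e_0 to e_l and commutes with \<open>a\<close>,
  so the single vector a e_0 determines \<open>a\<close> on the whole basis.\<close>

lemma torus_Linf_ket:
  assumes "a \<in> torus_Linf \<theta>"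
  shows "blinfun_apply a (ket l) = blinfun_apply (rtrans \<theta> l) (to_L2 a)"
proof -
  have "a o\<^sub>L rtrans \<theta> l = rtrans \<theta> l o\<^sub>L a"
    using assms rtrans_commutant[of \<theta> l]
    by (auto simp: torus_Linf_def vN_generated_def commutant_def[of "commutant _"])
  then have "blinfun_apply (a o\<^sub>L rtrans \<theta> l) (ket 0) = blinfun_apply (rtrans \<theta> l o\<^sub>L a) (ket 0)"
    by simp
  then show ?thesis
    by (simp add: rtrans_ket_0 to_L2_def)
qed

text \<open>That e_0 is separating gives the uniqueness behind the description in
  \<open>Linf_of\<close>.\<close>

lemma to_L2_inj:
  assumes "a \<in> torus_Linf \<theta>" "a' \<in> torus_Linf \<theta>" "to_L2 a = to_L2 a'"
  shows "a = a'"
  by (rule clinear_ops_eqI) (use assms in \<open>simp_all add: torus_Linf_clinear torus_Linf_ket\<close>)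

lemma Linf_of_to_L2: "a \<in> torus_Linf \<theta> \<Longrightarrow> Linf_of \<theta> (to_L2 a) = a"
  unfolding Linf_of_def by (rule the_equality) (auto intro: to_L2_inj)

text \<open>Expand the vector of \<open>b\<close> in kets and apply \<open>a\<close> termwise:
  \<open>a\<close> sends \<open>ket l\<close> to a right translate of its own vector, so the
  coordinates form a convolution twisted by \<open>rphase\<close>.\<close>

lemma coord_to_L2_compose:
  assumes "a \<in> torus_Linf \<theta>" "b \<in> clinear_ops"
  shows "((\<lambda>l. coord (to_L2 b) l * (rphase \<theta> (m - l) l * coord (to_L2 a) (m - l)))
           has_sum coord (to_L2 (a o\<^sub>L b)) m) UNIV"
  using has_sum_bounded_linear[OF bounded_linear_coord[of m]
      clinear_ops_has_sum[OF torus_Linf_clinear[OF assms(1)], of "to_L2 b"]]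
  by (simp add: torus_Linf_ket[OF assms(1)] scaleC.rep_eq coord_rtrans to_L2_def[of "a o\<^sub>L b"] to_L2_def[of b])

lemma to_L2_diff: "to_L2 (a - b) = to_L2 a - to_L2 b"
  by (simp add: to_L2_def blinfun.diff_left)

lemma to_L2_add: "to_L2 (a + b) = to_L2 a + to_L2 b"
  by (simp add: to_L2_def blinfun.add_left)

lemma to_L2_0: "to_L2 0 = 0"
  by (simp add: to_L2_def)

text \<open>The factors of U^m act on e_0 without producing phases, so the orthonormal system
  defining the Fourier coefficients is the canonical basis.\<close>

lemma fourier_eq_coord: "fourier \<theta> \<xi> m = coord \<xi> m"
  by (simp add: fourier_def to_L2_def Upow_ket_0)

text \<open>With absolutely summable coefficients the Fourier series converges in operator norm,
  each \<open>Upow \<theta> m\<close> being a contraction, and its sum stays in the von Neumann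
  algebra. This is the existence half for \<open>Linf_of\<close>.\<close>

lemma to_L2_surj_l1:
  fixes \<xi> :: "'n::{finite,linorder} zvec ell2"
  assumes "(\<lambda>m. cmod (coord \<xi> m)) summable_on UNIV"
  shows "\<exists>a\<in>torus_Linf \<theta>. to_L2 a = \<xi>"
proof -
  let ?f = "\<lambda>m. scal (coord \<xi> m) o\<^sub>L Upow \<theta> m"
  have "norm (?f m) \<le> cmod (coord \<xi> m)" for m
  proof -
    have "norm (?f m) \<le> norm (scal (coord \<xi> m) :: 'n zvec oper) * norm (Upow \<theta> m)"
      by (rule norm_blinfun_compose)
    also have "\<dots> \<le> cmod (coord \<xi> m) * 1"
      by (intro mult_mono norm_scal_le norm_Upow_le) auto
    finally show ?thesis by simp
  qed
  then have "?f abs_summable_on UNIV"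
    by (intro Infinite_Sum.abs_summable_on_comparison_test'[OF assms])
  then have "?f summable_on UNIV"
    by (rule abs_summable_summable)
  then obtain a where a: "(?f has_sum a) UNIV"
    unfolding summable_on_def ..
  have "a \<in> torus_Linf \<theta>"
    by (rule torus_Linf_has_sum_closed[OF a])
      (intro torus_Linf_compose torus_Linf_scal Upow_in_torus_Linf)
  moreover have "((\<lambda>m. scaleC (coord \<xi> m) (ket m)) has_sum to_L2 a) UNIV"
    using has_sum_bounded_linear[OF blinfun.bounded_linear_left a, of "ket 0"]
    by (simp add: to_L2_def Upow_ket_0)
  then have "to_L2 a = \<xi>"
    using has_sum_ket by (rule has_sum_unique)
  ultimately show ?thesis by blast
qed

lemma sq_norm_nonneg: "0 \<le> sq_norm m"
  by (simp add: sq_norm_def sum_nonneg)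

text \<open>The partial sums of the ket expansion come from trigonometric polynomials, which are
  smooth, so the image of the smooth algebra is dense.\<close>

lemma torus_L2_UNIV: "torus_L2 \<theta> = UNIV"
proof -
  have "x \<in> torus_L2 \<theta>" for x
    unfolding torus_L2_def
  proof (rule Lim_in_closed_set)
    show "((\<lambda>F. \<Sum>m\<in>F. scaleC (coord x m) (ket m)) \<longlongrightarrow> x) (finite_subsets_at_top UNIV)"
      using has_sum_ket[of x] unfolding has_sum_def .
    show "\<forall>\<^sub>F F in finite_subsets_at_top UNIV.
        (\<Sum>m\<in>F. scaleC (coord x m) (ket m)) \<in> closure (to_L2 ` torus_smooth \<theta>)"
    proof (rule eventually_finite_subsets_at_top_weakI)
      fix F :: "'a zvec set" assume F: "finite F"
      define c where "c m = (if m \<in> F then coord x m else 0)" for m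
      define a where "a = (\<Sum>m\<in>F. scal (c m) o\<^sub>L Upow \<theta> m)"
      have "rapidly_decreasing c"
        unfolding rapidly_decreasing_def
      proof
        fix p :: nat
        \<comment> \<open>By finite support, the sum over \<open>F\<close> serves as the bound
          \<open>B\<close> for the given \<open>p\<close>.\<close>
        have "(1 + sq_norm m) ^ p * cmod (c m) \<le> (\<Sum>l\<in>F. (1 + sq_norm l) ^ p * cmod (c l))" for m
        proof (cases "m \<in> F")
          case True
          then show ?thesis
            by (intro member_le_sum) (auto simp: F sq_norm_nonneg)
        next
          case False
          then show ?thesis
            by (simp add: c_def sum_nonneg sq_norm_nonneg)
        qed
        then show "\<exists>B. \<forall>m. (1 + sq_norm m) ^ p * cmod (c m) \<le> B" by blast
      qed
      moreover have "((\<lambda>m. scal (c m) o\<^sub>L Upow \<theta> m) has_sum a) UNIV"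
        by (rule has_sum_finite_neutralI[OF F])
          (auto simp: a_def c_def scaleC.rep_eq intro!: blinfun_eqI ell2_eqI)
      ultimately have "a \<in> torus_smooth \<theta>"
        unfolding torus_smooth_def by blast
      moreover have "to_L2 a = (\<Sum>m\<in>F. scaleC (coord x m) (ket m))"
        by (simp add: to_L2_def a_def blinfun.sum_left Upow_ket_0 c_def cong: sum.cong)
      ultimately show "(\<Sum>m\<in>F. scaleC (coord x m) (ket m)) \<in> closure (to_L2 ` torus_smooth \<theta>)"
        by (metis closure_subset image_eqI subsetD)
    qed
  qed auto
  then show ?thesis by blast
qed


section \<open>Sobolev norms\<close>

lemma summable_int_powr:
  assumes "1 < 2 * s"
  shows "(\<lambda>z::int. (1 + (real_of_int z)\<^sup>2) powr (- s)) summable_on UNIV"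
proof -
  let ?f = "\<lambda>z::int. (1 + (real_of_int z)\<^sup>2) powr (- s)"
  have "summable (\<lambda>n::nat. (1 + (real n)\<^sup>2) powr (- s))"
  proof (rule summable_comparison_test_ev)
    show "summable (\<lambda>n. real n powr (- 2 * s))"
      using assms by (simp add: summable_real_powr_iff)
    \<comment> \<open>At 0 the right-hand side is 0 by the convention for \<open>powr\<close>, so
      the comparison starts at 1.\<close>
    show "\<forall>\<^sub>F n in sequentially. norm ((1 + (real n)\<^sup>2) powr (- s)) \<le> real n powr (- 2 * s)"
    proof (rule eventually_sequentiallyI[of 1])
      fix n :: nat assume n: "1 \<le> n"
      have "(1 + (real n)\<^sup>2) powr (- s) \<le> ((real n)\<^sup>2) powr (- s)"
        by (rule powr_mono2') (use assms n in auto)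
      also have "\<dots> = (real n powr 2) powr (- s)"
        using n by simp
      also have "\<dots> = real n powr (- 2 * s)"
        by (simp only: powr_powr) simp
      finally show "norm ((1 + (real n)\<^sup>2) powr (- s)) \<le> real n powr (- 2 * s)"
        by simp
    qed
  qed
  then have nat: "(\<lambda>n::nat. (1 + (real n)\<^sup>2) powr (- s)) summable_on UNIV"
    by (simp add: summable_on_UNIV_nonneg_real_iff)
  have "?f summable_on range int"
    by (subst summable_on_reindex) (use nat in \<open>auto simp: comp_def\<close>)
  moreover have "?f summable_on range (\<lambda>n. - int n)"
    by (subst summable_on_reindex) (use nat in \<open>auto simp: comp_def inj_on_def\<close>)
  ultimately have "?f summable_on (range int \<union> range (\<lambda>n. - int n))"
    by (rule summable_on_union)
  moreover have "range int \<union> range (\<lambda>n. - int n) = UNIV"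
    by (auto, metis int_cases rangeI)
  ultimately show ?thesis by simp
qed

text \<open>Since \<open>1 + \<bar>m\<bar>\<^sup>2 \<ge> 1 + m\<^sub>j\<^sup>2\<close> for every \<open>j\<close>, the summand is dominated by the product over
  \<open>j\<close> of \<open>(1 + m\<^sub>j\<^sup>2)\<^bsup>-s/n\<^esup>\<close>.\<close>

lemma summable_sq_norm_powr:
  fixes s :: real
  assumes s: "real CARD('n::{finite,linorder}) / 2 < s"
  shows "(\<lambda>m :: 'n zvec. (1 + 4 * pi\<^sup>2 * sq_norm m) powr (- s)) summable_on UNIV"
proof (rule nonneg_bdd_above_summable_on)
  define n where "n = real CARD('n)"
  have n: "0 < n" by (simp add: n_def)
  have s0: "0 < s" using s n unfolding n_def[symmetric] by simp
  define g where "g z = (1 + (real_of_int z)\<^sup>2) powr (- (s / n))" for z :: int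
  \<comment> \<open>Sharing the exponent among n factors leaves \<open>s / n\<close> for each, and
    n/2 < s says exactly that \<open>1 < 2 * (s / n)\<close>.\<close>
  have g: "g summable_on UNIV"
    unfolding g_def by (rule summable_int_powr) (use s n in \<open>simp add: n_def field_simps\<close>)
  have dom: "(1 + 4 * pi\<^sup>2 * sq_norm m) powr (- s) \<le> (\<Prod>j\<in>UNIV. g (m $ j))" for m :: "'n zvec"
  proof -
    have "1 + 4 * pi\<^sup>2 * sq_norm m \<ge> 1 + (real_of_int (m $ j))\<^sup>2" for j
    proof -
      have "(real_of_int (m $ j))\<^sup>2 \<le> sq_norm m"
        unfolding sq_norm_def by (rule member_le_sum) auto
      also have "\<dots> \<le> (4 * pi\<^sup>2) * sq_norm m"
      proof -
        have "1 \<le> pi\<^sup>2" using pi_ge_two by (intro one_le_power) linarith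
        then have "1 * sq_norm m \<le> (4 * pi\<^sup>2) * sq_norm m"
          by (intro mult_right_mono sq_norm_nonneg) linarith
        then show ?thesis by simp
      qed
      finally show ?thesis by simp
    qed
    then have "(1 + 4 * pi\<^sup>2 * sq_norm m) powr (- (s / n)) \<le> g (m $ j)" for j
      unfolding g_def by (rule powr_mono2'[rotated 2]) (use s0 n in \<open>auto intro: add_pos_nonneg\<close>)
    then have "(\<Prod>j::'n\<in>UNIV. (1 + 4 * pi\<^sup>2 * sq_norm m) powr (- (s / n))) \<le> (\<Prod>j\<in>UNIV. g (m $ j))"
      by (intro prod_mono) auto
    also have "(\<Prod>j::'n\<in>UNIV. (1 + 4 * pi\<^sup>2 * sq_norm m) powr (- (s / n)))
        = (1 + 4 * pi\<^sup>2 * sq_norm m) powr (- s)"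
    proof -
      have p: "0 < 1 + 4 * pi\<^sup>2 * sq_norm m"
        using sq_norm_nonneg[of m] by (intro add_pos_nonneg) auto
      have "(\<Prod>j::'n\<in>UNIV. (1 + 4 * pi\<^sup>2 * sq_norm m) powr (- (s / n)))
          = ((1 + 4 * pi\<^sup>2 * sq_norm m) powr (- (s / n))) powr n"
        using p by (simp add: n_def powr_realpow)
      then show ?thesis
        using n by (simp add: powr_powr)
    qed
    finally show ?thesis .
  qed
  show "bdd_above (sum (\<lambda>m :: 'n zvec. (1 + 4 * pi\<^sup>2 * sq_norm m) powr (- s)) ` {F. F \<subseteq> UNIV \<and> finite F})"
  proof (rule bdd_aboveI2)
    fix F :: "'n zvec set"
    assume "F \<in> {F. F \<subseteq> UNIV \<and> finite F}"
    then have F: "finite F" by simp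
    have "(\<Sum>m\<in>F. (1 + 4 * pi\<^sup>2 * sq_norm m) powr (- s)) \<le> (\<Sum>m\<in>F. \<Prod>j\<in>UNIV. g (m $ j))"
      by (intro sum_mono dom)
    \<comment> \<open>Vectors become functions so that \<open>F\<close> can be enlarged to the box
      spanned by its coordinate projections, over which the sum of products factorises into a
      product of one-dimensional sums.\<close>
    also have "\<dots> = (\<Sum>h\<in>(($)) ` F. \<Prod>j\<in>UNIV. g (h j))"
      by (subst sum.reindex) (auto simp: inj_on_def vec_nth_inject)
    also have "\<dots> \<le> (\<Sum>h\<in>PiE UNIV (\<lambda>j. (\<lambda>m. m $ j) ` F). \<Prod>j\<in>UNIV. g (h j))"
      using F by (intro sum_mono2 finite_PiE) (auto simp: g_def intro!: prod_nonneg)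
    also have "\<dots> = (\<Prod>j\<in>UNIV. \<Sum>z\<in>(\<lambda>m. m $ j) ` F. g z)"
      using F by (intro prod_sum_PiE[symmetric]) auto
    also have "\<dots> \<le> (\<Prod>j::'n\<in>UNIV. infsum g UNIV)"
      using F by (intro prod_mono conjI finite_sum_le_infsum[OF g] sum_nonneg) (auto simp: g_def)
    finally show "(\<Sum>m\<in>F. (1 + 4 * pi\<^sup>2 * sq_norm m) powr (- s)) \<le> (\<Prod>j::'n\<in>UNIV. infsum g UNIV)" .
  qed
qed simp

section \<open>Weights and Sobolev norms in coordinates\<close>

definition sob_weight :: "real \<Rightarrow> 'n::{finite,linorder} zvec \<Rightarrow> real"
  where "sob_weight s m = (1 + 4 * pi\<^sup>2 * sq_norm m) powr (s / 2)"

lemma sob_weight_pos: "0 < sob_weight s m"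
proof -
  have "0 < 1 + 4 * pi\<^sup>2 * sq_norm m"
    using sq_norm_nonneg[of m] by (intro add_pos_nonneg) auto
  then show ?thesis by (simp add: sob_weight_def)
qed

lemma sob_weight_sq: "(sob_weight s m)\<^sup>2 = (1 + 4 * pi\<^sup>2 * sq_norm m) powr s"
  by (simp add: sob_weight_def power2_eq_square flip: powr_add)

text \<open>From |l+m|^2 \<le> 2(|l|^2 + |m|^2) the base at \<open>l + m\<close> is at most 4 times
  the larger of the two bases; the exponent \<open>s / 2\<close> turns 4 into
  \<open>2 powr s\<close>, and the maximum is at most the sum. This splitting takes the place of a
  Leibniz rule.\<close>

lemma sob_weight_add_le:
  assumes "0 \<le> s"
  shows "sob_weight s (l + m) \<le> 2 powr s * (sob_weight s l + sob_weight s m)"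
proof -
  define w where "w m = 1 + 4 * pi\<^sup>2 * sq_norm m" for m :: "'a zvec"
  have w1: "1 \<le> w m" for m
    using sq_norm_nonneg[of m] by (simp add: w_def)
  have "sq_norm (l + m) \<le> 2 * (sq_norm l + sq_norm m)"
  proof -
    have "(a + b)\<^sup>2 \<le> 2 * (a\<^sup>2 + b\<^sup>2)" for a b :: real
      using zero_le_power2[of "a - b"] by (simp add: power2_eq_square algebra_simps)
    then show ?thesis
      unfolding sq_norm_def sum.distrib[symmetric] sum_distrib_left by (intro sum_mono) auto
  qed
  then have "4 * pi\<^sup>2 * sq_norm (l + m) \<le> 4 * pi\<^sup>2 * (2 * (sq_norm l + sq_norm m))"
    by (intro mult_left_mono) auto
  then have "w (l + m) \<le> 2 * (w l + w m)"
    by (simp add: w_def algebra_simps)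
  also have "\<dots> \<le> 4 * max (w l) (w m)"
    by simp
  finally have "w (l + m) powr (s / 2) \<le> (4 * max (w l) (w m)) powr (s / 2)"
    using assms w1[of "l + m"] by (intro powr_mono2) auto
  also have "\<dots> = 4 powr (s / 2) * max (w l) (w m) powr (s / 2)"
    by (rule powr_mult)
  also have "4 powr (s / 2) = (2 powr 2 :: real) powr (s / 2)"
    by simp
  also have "\<dots> = 2 powr s"
    by (simp add: powr_powr)
  also have "max (w l) (w m) powr (s / 2) \<le> w l powr (s / 2) + w m powr (s / 2)"
    by (auto simp: max_def)
  finally show ?thesis
    by (simp add: sob_weight_def w_def)
qed

text \<open>The halved exponent in \<open>sob_weight\<close> makes the Sobolev norm the plain l2
  norm of the weighted coordinates.\<close>

lemma sob_term_eq: "sob_term \<theta> s \<xi> = (\<lambda>m. (sob_weight s m * cmod (coord \<xi> m))\<^sup>2)"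
  by (simp add: fun_eq_iff sob_term_def fourier_eq_coord power_mult_distrib sob_weight_sq)

lemma sob_term_eq_cmod: "sob_term \<theta> s \<xi> = (\<lambda>m. (cmod (of_real (sob_weight s m) * coord \<xi> m))\<^sup>2)"
  by (simp add: sob_term_eq norm_mult sob_weight_pos less_imp_le)

lemma mem_Sob_iff: "\<xi> \<in> Sob \<theta> s \<longleftrightarrow> (\<lambda>m. (sob_weight s m * cmod (coord \<xi> m))\<^sup>2) summable_on UNIV"
  by (simp add: Sob_def torus_L2_UNIV sob_term_eq)

lemma sob_norm_eq: "sob_norm \<theta> s \<xi> = sqrt (\<Sum>\<^sub>\<infinity>m. (sob_weight s m * cmod (coord \<xi> m))\<^sup>2)"
  by (simp add: sob_norm_def sob_term_eq)

lemma sob_norm_nonneg: "0 \<le> sob_norm \<theta> s \<xi>"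
  by (simp add: sob_norm_eq infsum_nonneg)

lemma zero_in_Sob: "0 \<in> Sob \<theta> s"
  by (simp add: mem_Sob_iff)

lemma sob_norm_0: "sob_norm \<theta> s 0 = 0"
  by (simp add: sob_norm_eq)

lemma
  assumes "\<xi> \<in> Sob \<theta> s" "\<eta> \<in> Sob \<theta> s"
  shows Sob_add: "\<xi> + \<eta> \<in> Sob \<theta> s"
    and sob_norm_triangle: "sob_norm \<theta> s (\<xi> + \<eta>) \<le> sob_norm \<theta> s \<xi> + sob_norm \<theta> s \<eta>"
  using summable_sq_add[of "\<lambda>m. of_real (sob_weight s m) * coord \<xi> m" "\<lambda>m. of_real (sob_weight s m) * coord \<eta> m"] assms
  by (simp_all add: Sob_def sob_norm_def torus_L2_UNIV sob_term_eq_cmod distrib_left)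

lemma Sob_uminus: "\<xi> \<in> Sob \<theta> s \<Longrightarrow> - \<xi> \<in> Sob \<theta> s"
  by (simp add: mem_Sob_iff)

lemma Sob_diff: "\<xi> \<in> Sob \<theta> s \<Longrightarrow> \<eta> \<in> Sob \<theta> s \<Longrightarrow> \<xi> - \<eta> \<in> Sob \<theta> s"
  using Sob_add[of \<xi> \<theta> s "- \<eta>"] by (simp add: Sob_uminus)

section \<open>Embedding into the absolutely convergent Fourier series\<close>

definition wiener_const :: "'n::{finite,linorder} itself \<Rightarrow> real \<Rightarrow> real"
  where "wiener_const _ s = sqrt (\<Sum>\<^sub>\<infinity>m::'n zvec. (1 + 4 * pi\<^sup>2 * sq_norm m) powr (- s))"

lemma wiener_const_nonneg: "0 \<le> wiener_const TYPE('n::{finite,linorder}) s"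
  by (simp add: wiener_const_def infsum_nonneg)

text \<open>Cauchy-Schwarz is applied to each coefficient written as reciprocal weight times
  weighted coefficient; \<open>wiener_const\<close> is the l2 norm of the reciprocal weight, finite
  because s > n/2.\<close>

lemma
  fixes \<xi> :: "'n::{finite,linorder} zvec ell2"
  assumes s: "real CARD('n) / 2 < s" and \<xi>: "\<xi> \<in> Sob \<theta> s"
  shows Sob_summable: "(\<lambda>m. cmod (coord \<xi> m)) summable_on UNIV"
    and Sob_l1_le: "(\<Sum>\<^sub>\<infinity>m. cmod (coord \<xi> m)) \<le> wiener_const TYPE('n) s * sob_norm \<theta> s \<xi>"
proof -
  have inv: "(1 / sob_weight s m)\<^sup>2 = (1 + 4 * pi\<^sup>2 * sq_norm m) powr (- s)" for m :: "'n zvec"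
    by (simp add: power_divide sob_weight_sq powr_minus_divide)
  have eq: "\<bar>1 / sob_weight s m * (sob_weight s m * cmod (coord \<xi> m))\<bar> = cmod (coord \<xi> m)" for m
    using sob_weight_pos[of s m] by simp
  note cs = cauchy_schwarz_infsum[of "\<lambda>m. 1 / sob_weight s m" "\<lambda>m. sob_weight s m * cmod (coord \<xi> m)",
      unfolded inv eq, OF summable_sq_norm_powr[OF s] \<xi>[unfolded mem_Sob_iff]]
  show "(\<lambda>m. cmod (coord \<xi> m)) summable_on UNIV"
    by (rule cs(1))
  show "(\<Sum>\<^sub>\<infinity>m. cmod (coord \<xi> m)) \<le> wiener_const TYPE('n) s * sob_norm \<theta> s \<xi>"
    using cs(2) by (simp add: wiener_const_def sob_norm_eq)
qed

text \<open>Absolute summability supplies a representing operator, and uniqueness makes it the one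
  that \<open>Linf_of\<close> picks.\<close>

lemma Linf_of_Sob:
  fixes \<xi> :: "'n::{finite,linorder} zvec ell2"
  assumes "real CARD('n) / 2 < s" "\<xi> \<in> Sob \<theta> s"
  shows "Linf_of \<theta> \<xi> \<in> torus_Linf \<theta>" "to_L2 (Linf_of \<theta> \<xi>) = \<xi>"
  using to_L2_surj_l1[OF Sob_summable[OF assms], of \<theta>] by (auto simp: Linf_of_to_L2)

section \<open>The algebra property of H^s\<close>

text \<open>The weight is split by \<open>sob_weight_add_le\<close> over the two arguments of the twisted convolution,
  and Young's inequality is applied to either half.\<close>

lemma
  fixes a b :: "'n::{finite,linorder} zvec oper"
  assumes s: "real CARD('n) / 2 < s"
    and a: "a \<in> torus_Linf \<theta>" "to_L2 a \<in> Sob \<theta> s"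
    and b: "b \<in> torus_Linf \<theta>" "to_L2 b \<in> Sob \<theta> s"
  shows Sob_compose: "to_L2 (a o\<^sub>L b) \<in> Sob \<theta> s"
    and sob_norm_compose_le: "sob_norm \<theta> s (to_L2 (a o\<^sub>L b))
      \<le> 2 * 2 powr s * wiener_const TYPE('n) s * sob_norm \<theta> s (to_L2 a) * sob_norm \<theta> s (to_L2 b)"
proof -
  have s0: "0 \<le> s" using s by (meson divide_nonneg_nonneg less_imp_le of_nat_0_le_iff order_trans zero_le_numeral)
  define w where "w = (sob_weight s :: 'n zvec \<Rightarrow> real)"
  have w0: "0 < w m" for m by (simp add: w_def sob_weight_pos)
  define f where "f m = cmod (coord (to_L2 a) m)" for m
  define g where "g m = cmod (coord (to_L2 b) m)" for m
  have fg0: "0 \<le> f m" "0 \<le> g m" for m by (simp_all add: f_def g_def)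
  have f1: "f summable_on UNIV" and g1: "g summable_on UNIV"
    unfolding f_def g_def by (rule Sob_summable[OF s]; fact)+
  have wf: "(\<lambda>m. (w m * f m)\<^sup>2) summable_on UNIV" and wg: "(\<lambda>m. (w m * g m)\<^sup>2) summable_on UNIV"
    using a(2) b(2) by (simp_all add: mem_Sob_iff w_def f_def g_def)
  \<comment> \<open>In \<open>F\<close> the weight rests on the coefficients of \<open>a\<close>, in
    \<open>G\<close> on those of \<open>b\<close>; the respective other factor is measured in
    l1.\<close>
  define F where "F m = (\<Sum>\<^sub>\<infinity>l. g l * (w (m - l) * f (m - l)))" for m
  define G where "G m = (\<Sum>\<^sub>\<infinity>l. f l * (w (m - l) * g (m - l)))" for m
  note yF = young_l1_l2[OF g1 fg0(2) wf, folded F_def]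
  note yG = young_l1_l2[OF f1 fg0(1) wg, folded G_def]
  define h where "h m = 2 powr s * F m + 2 powr s * G m" for m
  have pw: "w m * cmod (coord (to_L2 (a o\<^sub>L b)) m) \<le> h m" for m
  proof -
    \<comment> \<open>The reflection l -> m - l writes \<open>G m\<close> in the summation index of
      the product, so that the halves can be compared with it termwise. The twisting phase has
      modulus one and drops out of the comparison.\<close>
    have refl: "bij (\<lambda>l. m - l)"
      by (rule bij_betw_byWitness[where f' = "\<lambda>l. m - l"]) auto
    have G': "((\<lambda>l. f (m - l) * (w l * g l)) has_sum G m) UNIV"
      using has_sum_reindex_bij_betw[OF refl, of "\<lambda>l. f l * (w (m - l) * g (m - l))" "G m"]
        has_sum_infsum[OF yG(1)[of m]] by (simp add: G_def)
    have F': "((\<lambda>l. g l * (w (m - l) * f (m - l))) has_sum F m) UNIV"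
      using has_sum_infsum[OF yF(1)[of m]] by (simp add: F_def)
    have hs: "((\<lambda>l. 2 powr s * (g l * (w (m - l) * f (m - l))) + 2 powr s * (f (m - l) * (w l * g l)))
        has_sum h m) UNIV"
      unfolding h_def by (intro has_sum_add has_sum_cmult_right F' G')
    have prod: "((\<lambda>l. of_real (w m) * (coord (to_L2 b) l * (rphase \<theta> (m - l) l * coord (to_L2 a) (m - l))))
        has_sum of_real (w m) * coord (to_L2 (a o\<^sub>L b)) m) UNIV"
      by (rule has_sum_cmult_right[OF coord_to_L2_compose[OF a(1) torus_Linf_clinear[OF b(1)]]])
    have "cmod (of_real (w m) * coord (to_L2 (a o\<^sub>L b)) m) \<le> h m"
    proof (rule norm_infsum_le[OF prod hs])
      fix l
      have "w m \<le> 2 powr s * (w l + w (m - l))"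
        using sob_weight_add_le[OF s0, of l "m - l"] by (simp add: w_def)
      then have "w m * (g l * f (m - l)) \<le> 2 powr s * (w l + w (m - l)) * (g l * f (m - l))"
        using fg0 by (intro mult_right_mono) auto
      then show "cmod (of_real (w m) * (coord (to_L2 b) l * (rphase \<theta> (m - l) l * coord (to_L2 a) (m - l))))
          \<le> 2 powr s * (g l * (w (m - l) * f (m - l))) + 2 powr s * (f (m - l) * (w l * g l))"
        using w0[of m] by (simp add: norm_mult f_def g_def algebra_simps)
    qed
    then show ?thesis
      using w0[of m] by (simp add: norm_mult)
  qed
  have F0: "0 \<le> F m" and G0: "0 \<le> G m" for m
    unfolding F_def G_def by (intro infsum_nonneg mult_nonneg_nonneg fg0 less_imp_le[OF w0])+
  \<comment> \<open>The real sequences are viewed as complex ones so that Minkowski's inequality in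
    \<open>summable_sq_add\<close> applies to \<open>h\<close>.\<close>
  have sq: "(cmod (complex_of_real (2 powr s * F m)))\<^sup>2 = (2 powr s)\<^sup>2 * (F m)\<^sup>2"
    "(cmod (complex_of_real (2 powr s * G m)))\<^sup>2 = (2 powr s)\<^sup>2 * (G m)\<^sup>2"
    "(cmod (complex_of_real (2 powr s * F m) + complex_of_real (2 powr s * G m)))\<^sup>2 = (h m)\<^sup>2" for m
    unfolding of_real_add[symmetric] norm_of_real power2_abs by (simp_all add: power_mult_distrib h_def)
  note add = summable_sq_add[of "\<lambda>m. complex_of_real (2 powr s * F m)" "\<lambda>m. complex_of_real (2 powr s * G m)",
    unfolded sq, OF summable_on_cmult_right[OF yF(2)] summable_on_cmult_right[OF yG(2)]]
  have le: "(w m * cmod (coord (to_L2 (a o\<^sub>L b)) m))\<^sup>2 \<le> (h m)\<^sup>2" for m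
    using pw[of m] w0[of m] by (intro power_mono) auto
  have summ: "(\<lambda>m. (w m * cmod (coord (to_L2 (a o\<^sub>L b)) m))\<^sup>2) summable_on UNIV"
    by (rule summable_on_comparison_test[OF add(1)]) (use le in auto)
  then show "to_L2 (a o\<^sub>L b) \<in> Sob \<theta> s"
    by (simp add: mem_Sob_iff w_def)
  let ?W = "wiener_const TYPE('n) s" and ?a = "sob_norm \<theta> s (to_L2 a)" and ?b = "sob_norm \<theta> s (to_L2 b)"
  have "sqrt (\<Sum>\<^sub>\<infinity>m. (F m)\<^sup>2) \<le> (\<Sum>\<^sub>\<infinity>l. g l) * ?a"
    using yF(3) by (simp add: sob_norm_eq w_def f_def)
  also have "\<dots> \<le> (?W * ?b) * ?a"
    unfolding g_def by (intro mult_right_mono Sob_l1_le[OF s b(2)] sob_norm_nonneg)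
  finally have F2: "sqrt (\<Sum>\<^sub>\<infinity>m. (F m)\<^sup>2) \<le> ?W * ?a * ?b"
    by (simp add: mult_ac)
  have "sqrt (\<Sum>\<^sub>\<infinity>m. (G m)\<^sup>2) \<le> (\<Sum>\<^sub>\<infinity>l. f l) * ?b"
    using yG(3) by (simp add: sob_norm_eq w_def g_def)
  also have "\<dots> \<le> (?W * ?a) * ?b"
    unfolding f_def by (intro mult_right_mono Sob_l1_le[OF s a(2)] sob_norm_nonneg)
  finally have G2: "sqrt (\<Sum>\<^sub>\<infinity>m. (G m)\<^sup>2) \<le> ?W * ?a * ?b" .
  have "sob_norm \<theta> s (to_L2 (a o\<^sub>L b)) = sqrt (\<Sum>\<^sub>\<infinity>m. (w m * cmod (coord (to_L2 (a o\<^sub>L b)) m))\<^sup>2)"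
    by (simp add: sob_norm_eq w_def)
  also have "\<dots> \<le> sqrt (\<Sum>\<^sub>\<infinity>m. (h m)\<^sup>2)"
    by (intro real_sqrt_le_mono infsum_mono summ add(1) le)
  also have "\<dots> \<le> sqrt (\<Sum>\<^sub>\<infinity>m. (2 powr s)\<^sup>2 * (F m)\<^sup>2) + sqrt (\<Sum>\<^sub>\<infinity>m. (2 powr s)\<^sup>2 * (G m)\<^sup>2)"
    by (rule add(2))
  also have "\<dots> = 2 powr s * sqrt (\<Sum>\<^sub>\<infinity>m. (F m)\<^sup>2) + 2 powr s * sqrt (\<Sum>\<^sub>\<infinity>m. (G m)\<^sup>2)"
    by (simp add: infsum_cmult_right' real_sqrt_mult)
  \<comment> \<open>\<open>2 powr s\<close> comes from splitting the weight, the further factor 2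
    from the two halves having the same bound.\<close>
  also have "\<dots> \<le> 2 powr s * (?W * ?a * ?b) + 2 powr s * (?W * ?a * ?b)"
    by (intro add_mono mult_left_mono F2 G2) auto
  finally show "sob_norm \<theta> s (to_L2 (a o\<^sub>L b)) \<le> 2 * 2 powr s * ?W * ?a * ?b"
    by (simp add: mult_ac)
qed


section \<open>Noncommutative polynomials\<close>

text \<open>Below 1 the constant dominates, above 1 the higher power does. This absorbs all lower
  degrees into one bound.\<close>

lemma power_le_one_plus_power:
  fixes x :: real
  assumes "0 \<le> x" "d \<le> e"
  shows "x ^ d \<le> 1 + x ^ e"
proof (cases "x \<le> 1")
  case True
  then show ?thesis
    using assms power_le_one[of x d] zero_le_power[of x e] by linarith
next
  case False
  then have "x ^ d \<le> x ^ e"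
    by (intro power_increasing assms) simp
  then show ?thesis by simp
qed

text \<open>The features of the Sobolev algebra on which the estimates rest. Working with operators
  makes the product a composition, and \<open>K\<close> records that the norm is submultiplicative
  up to a constant.\<close>

locale normed_oper_algebra =
  fixes S :: "'i oper set" and nrm :: "'i oper \<Rightarrow> real" and K :: real
  assumes zero: "0 \<in> S" "nrm 0 = 0"
    and add: "a \<in> S \<Longrightarrow> b \<in> S \<Longrightarrow> a + b \<in> S"
    and diff: "a \<in> S \<Longrightarrow> b \<in> S \<Longrightarrow> a - b \<in> S"
    and compose: "a \<in> S \<Longrightarrow> b \<in> S \<Longrightarrow> a o\<^sub>L b \<in> S"
    and nonneg: "0 \<le> nrm a"
    and triangle: "a \<in> S \<Longrightarrow> b \<in> S \<Longrightarrow> nrm (a + b) \<le> nrm a + nrm b"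
    and submult: "a \<in> S \<Longrightarrow> b \<in> S \<Longrightarrow> nrm (a o\<^sub>L b) \<le> K * nrm a * nrm b"
    and K_nonneg: "0 \<le> K"
begin

definition poly_growth :: "nat \<Rightarrow> ('i oper \<Rightarrow> 'i oper) \<Rightarrow> bool"
  where "poly_growth d \<Phi> \<longleftrightarrow> (\<exists>C\<ge>0. \<forall>u\<in>S. nrm (\<Phi> u) \<le> C * (1 + nrm u ^ d))"

definition lipschitz_on_balls :: "('i oper \<Rightarrow> 'i oper) \<Rightarrow> bool"
  where "lipschitz_on_balls \<Phi> \<longleftrightarrow> (\<forall>R\<ge>0. \<exists>L\<ge>0. \<forall>u\<in>S. \<forall>v\<in>S.
    nrm u \<le> R \<longrightarrow> nrm v \<le> R \<longrightarrow> nrm (\<Phi> u - \<Phi> v) \<le> L * nrm (u - v))"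

text \<open>Invariance, growth and the Lipschitz bound are carried through the induction together,
  because the Lipschitz bound of a product draws on the other two for its factors.\<close>

definition poly_map :: "nat \<Rightarrow> ('i oper \<Rightarrow> 'i oper) \<Rightarrow> bool"
  where "poly_map d \<Phi> \<longleftrightarrow> \<Phi> ` S \<subseteq> S \<and> poly_growth d \<Phi> \<and> lipschitz_on_balls \<Phi>"

lemma submult3:
  assumes "a \<in> S" "b \<in> S" "c \<in> S"
  shows "nrm (a o\<^sub>L b o\<^sub>L c) \<le> K\<^sup>2 * nrm a * nrm b * nrm c"
proof -
  have "nrm (a o\<^sub>L b o\<^sub>L c) \<le> K * nrm (a o\<^sub>L b) * nrm c"
    by (intro submult compose assms)
  also have "\<dots> \<le> K * (K * nrm a * nrm b) * nrm c"
    by (intro mult_right_mono mult_left_mono submult assms nonneg K_nonneg)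
  finally show ?thesis by (simp add: power2_eq_square mult_ac)
qed

lemma poly_map_const:
  assumes "b \<in> S"
  shows "poly_map 0 (\<lambda>_. b)"
proof -
  have "\<exists>C\<ge>0. \<forall>u\<in>S. nrm b \<le> C * (1 + nrm u ^ 0)"
    by (rule exI[of _ "nrm b"]) (simp add: nonneg)
  then show ?thesis
    using assms by (auto simp: poly_map_def poly_growth_def lipschitz_on_balls_def zero)
qed

text \<open>Brings monomials to a common degree at the price of doubling \<open>C\<close>, since 2 +
  x^e \<le> 2(1 + x^e).\<close>

lemma poly_map_mono:
  assumes "poly_map d \<Phi>" "d \<le> e"
  shows "poly_map e \<Phi>"
proof -
  obtain C where C: "0 \<le> C" "\<And>u. u \<in> S \<Longrightarrow> nrm (\<Phi> u) \<le> C * (1 + nrm u ^ d)"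
    using assms(1) by (auto simp: poly_map_def poly_growth_def)
  have "nrm (\<Phi> u) \<le> (2 * C) * (1 + nrm u ^ e)" if "u \<in> S" for u
  proof -
    have "nrm (\<Phi> u) \<le> C * (1 + nrm u ^ d)" by (rule C(2)[OF that])
    also have "\<dots> \<le> C * (1 + (1 + nrm u ^ e))"
      by (intro mult_left_mono add_mono power_le_one_plus_power nonneg assms C) simp
    also have "\<dots> \<le> C * (2 * (1 + nrm u ^ e))"
      using nonneg[of u] by (intro mult_left_mono C) simp
    finally show ?thesis by (simp only: mult_ac)
  qed
  then have "poly_growth e \<Phi>"
    unfolding poly_growth_def using C(1) by (intro exI[of _ "2 * C"]) auto
  with assms(1) show ?thesis
    by (simp add: poly_map_def)
qed

lemma poly_map_mult:
  assumes "poly_map d \<Phi>" "b \<in> S"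
  shows "poly_map (Suc d) (\<lambda>u. \<Phi> u o\<^sub>L u o\<^sub>L b)"
proof -
  have maps: "\<Phi> u \<in> S" if "u \<in> S" for u
    using assms(1) that by (auto simp: poly_map_def)
  obtain C where C: "0 \<le> C" "\<And>u. u \<in> S \<Longrightarrow> nrm (\<Phi> u) \<le> C * (1 + nrm u ^ d)"
    using assms(1) by (auto simp: poly_map_def poly_growth_def)
  have "nrm (\<Phi> u o\<^sub>L u o\<^sub>L b) \<le> (2 * K\<^sup>2 * C * nrm b) * (1 + nrm u ^ Suc d)" if u: "u \<in> S" for u
  proof -
    have "nrm (\<Phi> u o\<^sub>L u o\<^sub>L b) \<le> K\<^sup>2 * nrm (\<Phi> u) * nrm u * nrm b"
      by (rule submult3[OF maps[OF u] u assms(2)])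
    also have "\<dots> \<le> K\<^sup>2 * (C * (1 + nrm u ^ d)) * nrm u * nrm b"
      by (intro mult_right_mono mult_left_mono C u nonneg) simp
    also have "\<dots> = (K\<^sup>2 * C * nrm b) * (nrm u ^ 1 + nrm u ^ Suc d)"
      by (simp add: algebra_simps)
    also have "\<dots> \<le> (K\<^sup>2 * C * nrm b) * ((1 + nrm u ^ Suc d) + nrm u ^ Suc d)"
      by (intro mult_left_mono add_mono power_le_one_plus_power mult_nonneg_nonneg nonneg C) auto
    also have "\<dots> \<le> (K\<^sup>2 * C * nrm b) * (2 * (1 + nrm u ^ Suc d))"
      by (intro mult_left_mono mult_nonneg_nonneg nonneg C) auto
    finally show ?thesis by (simp only: mult_ac)
  qed
  then have "poly_growth (Suc d) (\<lambda>u. \<Phi> u o\<^sub>L u o\<^sub>L b)"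
    unfolding poly_growth_def using C(1)
    by (intro exI[of _ "2 * K\<^sup>2 * C * nrm b"]) (auto intro!: mult_nonneg_nonneg nonneg)
  moreover have "lipschitz_on_balls (\<lambda>u. \<Phi> u o\<^sub>L u o\<^sub>L b)"
    unfolding lipschitz_on_balls_def
  proof (intro allI impI)
    fix R :: real assume R: "0 \<le> R"
    obtain L where L: "0 \<le> L"
      "\<And>u v. u \<in> S \<Longrightarrow> v \<in> S \<Longrightarrow> nrm u \<le> R \<Longrightarrow> nrm v \<le> R \<Longrightarrow> nrm (\<Phi> u - \<Phi> v) \<le> L * nrm (u - v)"
      using assms(1) R unfolding poly_map_def lipschitz_on_balls_def by meson
    \<comment> \<open>\<open>B\<close> bounds \<open>nrm (\<Phi> v)\<close> on the ball. In
      \<open>L'\<close> the part \<open>L * R\<close> pays for the change of \<open>\<Phi>\<close>,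
      and \<open>B\<close> for the change of the appended factor \<open>u\<close>.\<close>
    define B where "B = C * (1 + R ^ d)"
    have B: "0 \<le> B" using R C(1) by (simp add: B_def)
    define L' where "L' = K\<^sup>2 * nrm b * (L * R + B)"
    have "0 \<le> L'"
      unfolding L'_def using B R L(1) by (intro mult_nonneg_nonneg nonneg) auto
    moreover have "nrm ((\<Phi> u o\<^sub>L u o\<^sub>L b) - (\<Phi> v o\<^sub>L v o\<^sub>L b)) \<le> L' * nrm (u - v)"
      if u: "u \<in> S" "nrm u \<le> R" and v: "v \<in> S" "nrm v \<le> R" for u v
    proof -
      \<comment> \<open>Telescoping: one factor is changed at a time.\<close>
      have "(\<Phi> u o\<^sub>L u o\<^sub>L b) - (\<Phi> v o\<^sub>L v o\<^sub>L b)
          = ((\<Phi> u - \<Phi> v) o\<^sub>L u o\<^sub>L b) + (\<Phi> v o\<^sub>L (u - v) o\<^sub>L b)"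
        by (rule blinfun_eqI) (simp add: blinfun.bilinear_simps)
      then have "nrm ((\<Phi> u o\<^sub>L u o\<^sub>L b) - (\<Phi> v o\<^sub>L v o\<^sub>L b))
          \<le> nrm ((\<Phi> u - \<Phi> v) o\<^sub>L u o\<^sub>L b) + nrm (\<Phi> v o\<^sub>L (u - v) o\<^sub>L b)"
        using triangle[of "(\<Phi> u - \<Phi> v) o\<^sub>L u o\<^sub>L b" "\<Phi> v o\<^sub>L (u - v) o\<^sub>L b"]
        by (simp add: compose diff maps u v assms(2))
      also have "\<dots> \<le> K\<^sup>2 * nrm (\<Phi> u - \<Phi> v) * nrm u * nrm b + K\<^sup>2 * nrm (\<Phi> v) * nrm (u - v) * nrm b"
        by (intro add_mono submult3 diff maps u v assms(2))
      also have "\<dots> \<le> K\<^sup>2 * (L * nrm (u - v)) * R * nrm b + K\<^sup>2 * B * nrm (u - v) * nrm b"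
      proof -
        have "nrm (\<Phi> v) \<le> C * (1 + nrm v ^ d)" by (rule C(2)[OF v(1)])
        also have "\<dots> \<le> B"
          unfolding B_def by (intro mult_left_mono add_left_mono power_mono v nonneg C)
        finally have "nrm (\<Phi> v) \<le> B" .
        moreover have "nrm (\<Phi> u - \<Phi> v) \<le> L * nrm (u - v)"
          by (intro L u v)
        ultimately show ?thesis
          using u(2) L(1) by (intro add_mono mult_right_mono mult_mono mult_left_mono nonneg mult_nonneg_nonneg) auto
      qed
      also have "\<dots> = L' * nrm (u - v)"
        by (simp add: L'_def algebra_simps)
      finally show ?thesis .
    qed
    ultimately show "\<exists>L\<ge>0. \<forall>u\<in>S. \<forall>v\<in>S. nrm u \<le> R \<longrightarrow> nrm v \<le> R \<longrightarrow>
        nrm ((\<Phi> u o\<^sub>L u o\<^sub>L b) - (\<Phi> v o\<^sub>L v o\<^sub>L b)) \<le> L * nrm (u - v)"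
      by blast
  qed
  ultimately show ?thesis
    by (auto simp: poly_map_def compose maps assms(2))
qed

lemma poly_map_add:
  assumes "poly_map d \<Phi>" "poly_map d \<Psi>"
  shows "poly_map d (\<lambda>u. \<Phi> u + \<Psi> u)"
proof -
  have maps: "\<Phi> u \<in> S" "\<Psi> u \<in> S" if "u \<in> S" for u
    using assms that by (auto simp: poly_map_def)
  obtain C D where CD: "0 \<le> C" "\<And>u. u \<in> S \<Longrightarrow> nrm (\<Phi> u) \<le> C * (1 + nrm u ^ d)"
    "0 \<le> D" "\<And>u. u \<in> S \<Longrightarrow> nrm (\<Psi> u) \<le> D * (1 + nrm u ^ d)"
    using assms by (auto simp: poly_map_def poly_growth_def)
  have "nrm (\<Phi> u + \<Psi> u) \<le> (C + D) * (1 + nrm u ^ d)" if "u \<in> S" for u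
    using triangle[OF maps[OF that]] CD(2,4)[OF that] unfolding distrib_right[of C D] by linarith
  then have "poly_growth d (\<lambda>u. \<Phi> u + \<Psi> u)"
    unfolding poly_growth_def using CD(1,3) by (intro exI[of _ "C + D"]) auto
  moreover have "lipschitz_on_balls (\<lambda>u. \<Phi> u + \<Psi> u)"
    unfolding lipschitz_on_balls_def
  proof (intro allI impI)
    fix R :: real assume R: "0 \<le> R"
    obtain L where L: "0 \<le> L"
      "\<And>u v. u \<in> S \<Longrightarrow> v \<in> S \<Longrightarrow> nrm u \<le> R \<Longrightarrow> nrm v \<le> R \<Longrightarrow> nrm (\<Phi> u - \<Phi> v) \<le> L * nrm (u - v)"
      using assms(1) R unfolding poly_map_def lipschitz_on_balls_def by meson
    obtain M where M: "0 \<le> M"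
      "\<And>u v. u \<in> S \<Longrightarrow> v \<in> S \<Longrightarrow> nrm u \<le> R \<Longrightarrow> nrm v \<le> R \<Longrightarrow> nrm (\<Psi> u - \<Psi> v) \<le> M * nrm (u - v)"
      using assms(2) R unfolding poly_map_def lipschitz_on_balls_def by meson
    have "nrm ((\<Phi> u + \<Psi> u) - (\<Phi> v + \<Psi> v)) \<le> (L + M) * nrm (u - v)"
      if "u \<in> S" "v \<in> S" "nrm u \<le> R" "nrm v \<le> R" for u v
    proof -
      have "nrm ((\<Phi> u - \<Phi> v) + (\<Psi> u - \<Psi> v)) \<le> nrm (\<Phi> u - \<Phi> v) + nrm (\<Psi> u - \<Psi> v)"
        by (intro triangle diff maps that)
      also have "\<dots> \<le> (L + M) * nrm (u - v)"
        unfolding distrib_right by (intro add_mono L M that)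
      finally show ?thesis by (simp add: algebra_simps)
    qed
    moreover have "0 \<le> L + M" using L M by simp
    ultimately show "\<exists>L\<ge>0. \<forall>u\<in>S. \<forall>v\<in>S. nrm u \<le> R \<longrightarrow> nrm v \<le> R \<longrightarrow>
        nrm (\<Phi> u + \<Psi> u - (\<Phi> v + \<Psi> v)) \<le> L * nrm (u - v)"
      by blast
  qed
  ultimately show ?thesis
    by (auto simp: poly_map_def add maps)
qed

lemma poly_map_sum:
  assumes "\<And>i. i \<in> I \<Longrightarrow> poly_map d (\<Phi> i)"
  shows "poly_map d (\<lambda>u. \<Sum>i\<in>I. \<Phi> i u)"
proof -
  \<comment> \<open>The zero map covers the empty sum and also infinite \<open>I\<close>, where the
    sum is 0 by convention.\<close>
  have 0: "poly_map d (\<lambda>_. 0)"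
    by (rule poly_map_mono[OF poly_map_const[OF zero(1)]]) simp
  show ?thesis
    using assms by (induction I rule: infinite_finite_induct) (auto intro: 0 poly_map_add)
qed

text \<open>Each recursion step of \<open>nc_monomial\<close> appends one \<open>u\<close> and one
  coefficient, which is the situation of \<open>poly_map_mult\<close>.\<close>

lemma poly_map_nc_monomial:
  "(\<And>i. i \<le> \<nu> \<Longrightarrow> \<beta> i \<in> S) \<Longrightarrow> poly_map \<nu> (\<lambda>u. nc_monomial \<beta> u \<nu>)"
  by (induction \<nu>) (auto intro: poly_map_const poly_map_mult)

end

section \<open>Transfer of the operator estimates to Sobolev vectors\<close>

theorem proposition4p3:
  fixes \<theta> :: "'n::{finite,linorder} rmat"
    and k q :: nat
    and N :: "nat \<Rightarrow> nat"
    and b :: "nat \<Rightarrow> nat \<Rightarrow> nat \<Rightarrow> ('n::{finite,linorder} zvec) ell2"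
  assumes "transpose \<theta> = - \<theta>"
    and "1 \<le> k" and "real k > real CARD('n) / 2"
    and "1 \<le> q"
    and "\<And>\<nu> \<mu> i. \<nu> \<le> q \<Longrightarrow> \<mu> \<in> {1..N \<nu>} \<Longrightarrow> i \<le> \<nu> \<Longrightarrow> b \<nu> \<mu> i \<in> Sob \<theta> (real k)"
  shows "locally_lipschitz (Sob \<theta> (real k)) (sob_norm \<theta> (real k)) (nc_poly \<theta> q N b)
    \<and> (\<exists>C>0. \<forall>u \<in> Sob \<theta> (real k).
          sob_norm \<theta> (real k) (nc_poly \<theta> q N b u) \<le> C * (1 + sob_norm \<theta> (real k) u ^ q))
    \<and> (\<forall>R>0. \<exists>C>0. \<forall>u \<in> Sob \<theta> (real k). \<forall>v \<in> Sob \<theta> (real k).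
          sob_norm \<theta> (real k) u \<le> R \<longrightarrow> sob_norm \<theta> (real k) v \<le> R \<longrightarrow>
          sob_norm \<theta> (real k) (nc_poly \<theta> q N b u - nc_poly \<theta> q N b v)
            \<le> C * sob_norm \<theta> (real k) (u - v))"
proof -
  define s where "s = real k"
  have s: "real CARD('n) / 2 < s" using assms(3) by (simp add: s_def)
  \<comment> \<open>\<open>S\<close> is H^s realised inside L^infty: \<open>to_L2\<close> maps it
    onto \<open>Sob \<theta> s\<close> with inverse \<open>Linf_of \<theta>\<close>, and
    \<open>nrm\<close> is the transported norm.\<close>
  define S where "S = {a \<in> torus_Linf \<theta>. to_L2 a \<in> Sob \<theta> s}"
  define nrm where "nrm a = sob_norm \<theta> s (to_L2 a)" for a :: "'n zvec oper"
  interpret normed_oper_algebra S nrm "2 * 2 powr s * wiener_const TYPE('n) s"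
  proof
    fix a b :: "'n zvec oper"
    assume "a \<in> S" "b \<in> S"
    then have ab: "a \<in> torus_Linf \<theta>" "to_L2 a \<in> Sob \<theta> s" "b \<in> torus_Linf \<theta>" "to_L2 b \<in> Sob \<theta> s"
      by (auto simp: S_def)
    show "a + b \<in> S" "a - b \<in> S" "a o\<^sub>L b \<in> S"
      using ab by (simp_all add: S_def torus_Linf_add torus_Linf_diff torus_Linf_compose
          to_L2_add to_L2_diff Sob_add Sob_diff Sob_compose[OF s])
    show "nrm (a + b) \<le> nrm a + nrm b"
      using ab by (simp add: nrm_def to_L2_add sob_norm_triangle)
    show "nrm (a o\<^sub>L b) \<le> 2 * 2 powr s * wiener_const TYPE('n) s * nrm a * nrm b"
      unfolding nrm_def by (rule sob_norm_compose_le[OF s ab])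
  qed (simp_all add: S_def nrm_def torus_Linf_0 to_L2_0 zero_in_Sob sob_norm_0 sob_norm_nonneg wiener_const_nonneg)
  \<comment> \<open>The polynomial on operators; \<open>nc_poly\<close> is \<open>P\<close>
    conjugated by this identification.\<close>
  define P where "P u = (\<Sum>\<nu>=0..q. \<Sum>\<mu>=1..N \<nu>. nc_monomial (\<lambda>i. Linf_of \<theta> (b \<nu> \<mu> i)) u \<nu>)" for u
  have Linf: "Linf_of \<theta> u \<in> S" "to_L2 (Linf_of \<theta> u) = u" if "u \<in> Sob \<theta> s" for u
    using that Linf_of_Sob[OF s that] by (simp_all add: S_def)
  have "poly_map q P"
    unfolding P_def
  proof (intro poly_map_sum)
    fix \<nu> \<mu> assume "\<nu> \<in> {0..q}" "\<mu> \<in> {1..N \<nu>}"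
    then show "poly_map q (\<lambda>u. nc_monomial (\<lambda>i. Linf_of \<theta> (b \<nu> \<mu> i)) u \<nu>)"
      using assms(5) by (intro poly_map_mono[OF poly_map_nc_monomial]) (auto intro!: Linf(1) simp: s_def)
  qed
  then have maps: "\<And>u. u \<in> S \<Longrightarrow> P u \<in> S" and growth: "poly_growth q P" and lip: "lipschitz_on_balls P"
    by (auto simp: poly_map_def)
  have nc: "nc_poly \<theta> q N b u = to_L2 (P (Linf_of \<theta> u))" for u
    by (simp add: nc_poly_def P_def)
  have nrm_Linf: "nrm (Linf_of \<theta> u) = sob_norm \<theta> s u" if "u \<in> Sob \<theta> s" for u
    by (simp add: nrm_def Linf that)
  have bound: "\<exists>C>0. \<forall>u\<in>Sob \<theta> s. sob_norm \<theta> s (nc_poly \<theta> q N b u) \<le> C * (1 + sob_norm \<theta> s u ^ q)"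
  proof -
    obtain C where C: "0 \<le> C" "\<And>u. u \<in> S \<Longrightarrow> nrm (P u) \<le> C * (1 + nrm u ^ q)"
      using growth by (auto simp: poly_growth_def)
    \<comment> \<open>Adding 1 makes the constant strictly positive; \<open>L + 1\<close> does the
      same in the Lipschitz bound.\<close>
    have "sob_norm \<theta> s (nc_poly \<theta> q N b u) \<le> (C + 1) * (1 + sob_norm \<theta> s u ^ q)"
      if u: "u \<in> Sob \<theta> s" for u
    proof -
      have "sob_norm \<theta> s (nc_poly \<theta> q N b u) \<le> C * (1 + sob_norm \<theta> s u ^ q)"
        using C(2)[OF Linf(1)[OF u]] by (simp add: nrm_Linf[OF u]) (simp add: nrm_def nc)
      also have "\<dots> \<le> (C + 1) * (1 + sob_norm \<theta> s u ^ q)"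
        using sob_norm_nonneg[of \<theta> s u] by (intro mult_right_mono) auto
      finally show ?thesis .
    qed
    then show ?thesis
      using C(1) by (intro exI[of _ "C + 1"]) auto
  qed
  have lipschitz: "\<exists>C>0. \<forall>u\<in>Sob \<theta> s. \<forall>v\<in>Sob \<theta> s. sob_norm \<theta> s u \<le> R \<longrightarrow> sob_norm \<theta> s v \<le> R \<longrightarrow>
      sob_norm \<theta> s (nc_poly \<theta> q N b u - nc_poly \<theta> q N b v) \<le> C * sob_norm \<theta> s (u - v)"
    if R: "0 < R" for R
  proof -
    obtain L where L: "0 \<le> L"
      "\<And>u v. u \<in> S \<Longrightarrow> v \<in> S \<Longrightarrow> nrm u \<le> R \<Longrightarrow> nrm v \<le> R \<Longrightarrow> nrm (P u - P v) \<le> L * nrm (u - v)"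
      using lip less_imp_le[OF R] unfolding lipschitz_on_balls_def by meson
    have "sob_norm \<theta> s (nc_poly \<theta> q N b u - nc_poly \<theta> q N b v) \<le> (L + 1) * sob_norm \<theta> s (u - v)"
      if uv: "u \<in> Sob \<theta> s" "v \<in> Sob \<theta> s" "sob_norm \<theta> s u \<le> R" "sob_norm \<theta> s v \<le> R" for u v
    proof -
      have "nrm (P (Linf_of \<theta> u) - P (Linf_of \<theta> v)) \<le> L * nrm (Linf_of \<theta> u - Linf_of \<theta> v)"
        using uv by (intro L Linf) (simp_all add: nrm_Linf)
      then have "sob_norm \<theta> s (nc_poly \<theta> q N b u - nc_poly \<theta> q N b v) \<le> L * sob_norm \<theta> s (u - v)"
        using uv by (simp add: nrm_def to_L2_diff nc Linf)
      also have "\<dots> \<le> (L + 1) * sob_norm \<theta> s (u - v)"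
        by (intro mult_right_mono sob_norm_nonneg) simp
      finally show ?thesis .
    qed
    then show ?thesis
      using L(1) by (intro exI[of _ "L + 1"]) auto
  qed
  have "nc_poly \<theta> q N b ` Sob \<theta> s \<subseteq> Sob \<theta> s"
    using maps[OF Linf(1)] by (auto simp: nc S_def)
  then have "locally_lipschitz (Sob \<theta> s) (sob_norm \<theta> s) (nc_poly \<theta> q N b)"
    unfolding locally_lipschitz_def using lipschitz by blast
  then show ?thesis
    using bound lipschitz unfolding s_def by blast
qed

end
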